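(* Let $I$ be an umbral graph polynomial invariant with values in the polynomial ring $\mathbb{C}[q_1,q_2,\dots]$ in infinitely many variables. Define two generating functions by $$\mathcal{I}^\circ(q_1,q_2,\dots)=\sum_{G}\frac{I_G(q_1,q_2,\dots)}{|\mathrm{Aut}(G)|},\qquad \mathcal{I}(q_1,q_2,\dots)=\sum_{G\text{ connected}}\frac{I_G(q_1,q_2,\dots)}{|\mathrm{Aut}(G)|},$$ where the first summation is carried over all graphs (isomorphism classes of simple graphs, including the empty graph), the second one over all connected graphs (isomorphism classes of non-empty connected simple graphs), and $|\mathrm{Aut}(G)|$ denotes the order of the automorphism group of the graph $G$. Then after an appropriate rescaling of the variables $$q_n=\frac{2^{n(n-1)/2}(n-1)!}{i_n}\,p_n,$$ where $i_n$, $n=1,2,\dots$, are some constants, the generating function $\mathcal{I}$ becomes a solution to the KP hierarchy of partial differential equations. After the same rescaling of the variables the generating function $\mathcal{I}^\circ$ becomes a $\tau$-function of the KP hierarchy. The rescaling constants $i_n$ are given by the sum $$i_n=n!\sum_{G\text{ connected}}\frac{[q_n]I_G(q_1,q_2,\dots)}{|\mathrm{Aut}(G)|}$$ of the coefficients of $q_n$, where $[q_n]I_G$ denotes the coefficient of the monomial $q_n$ in $I_G$.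
   Context: Graphs are finite; a simple graph has no loops or multiple edges. $\mathrm{Aut}(G)$ is the automorphism group of $G$ and $|\mathrm{Aut}(G)|$ its order. The empty graph is not counted as connected. Hopf algebra of graphs. $\mathcal{G}=\bigoplus_{n\ge0}\mathcal{G}_n$ is the graded vector space over $\mathbb{C}$ with basis the isomorphism classes of simple graphs, $\mathcal{G}_n$ being spanned by graphs with $n$ vertices. The product is disjoint union (unit: the empty graph) and the coproduct is $\Delta(G)=\sum_{V(G)=V_1\sqcup V_2}G(V_1)\otimes G(V_2)$, the sum over ordered partitions of $V(G)$ into two (possibly empty) subsets, with $G(V_i)$ the induced subgraph; the counit is $1$ on the empty graph and $0$ on all other graphs. This is a commutative cocommutative graded Hopf algebra. The polynomial ring $\mathbb{C}[q_1,q_2,\dots]$ is a graded Hopf algebra with its usual multiplication, $\deg q_n=n$ and $\Delta(q_n)=q_n\otimes1+1\otimes q_n$. An umbral graph polynomial invariant is an arbitrary homomorphism of graded Hopf algebras $I:\mathcal{G}\to\mathbb{C}[q_1,q_2,\dots]$, $G\mapsto I_G$. KP hierarchy. Define one-part Schur polynomials $s_n(p_1,p_2,\dots)$ by $\sum_{n\ge0}s_n=\exp\left(\sum_{k\ge1}p_k/k\right)$ ($s_n$ being the part of weighted degree $n$, with $p_i$ of degree $i$; $s_n=0$ for $n<0$), and for a partition $\lambda=(\lambda_1\ge\dots\ge\lambda_l)$ put $s_\lambda=\det(s_{\lambda_i-i+j})_{1\le i,j\le l}$. A $\tau$-function of the KP hierarchy is a formal power series in $p_1,p_2,\dots$ obtained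 as follows. Take formal Laurent series $\beta_i(z)=z^{-i}+c_{i1}z^{-i+1}+c_{i2}z^{-i+2}+\cdots$, $i=1,2,\dots$, and expand the semi-infinite wedge product $\beta_1\wedge\beta_2\wedge\beta_3\wedge\cdots=\sum_\mu c_\mu v_\mu$ over partitions $\mu$, where $v_\mu=z^{m_1}\wedge z^{m_2}\wedge\cdots$ with $m_i=\mu_i-i$ ($\mu_i=0$ for $i$ large), normalized so that the coefficient $c_\emptyset$ of the vacuum vector $v_\emptyset=z^{-1}\wedge z^{-2}\wedge\cdots$ is $1$. The corresponding $\tau$-function is $\sum_\mu c_\mu s_\mu(p_1,p_2,\dots)$. Solutions of the KP hierarchy are the logarithms of $\tau$-functions (the KP equations are the form taken by the Hirota, i.e. Plücker, equations for the coefficients $c_\mu$ when rewritten for the logarithm of the $\tau$-function; the first of them is $\frac{\partial^2F}{\partial p_2^2}=\frac{\partial^2F}{\partial p_1\partial p_3}-\frac12\left(\frac{\partial^2F}{\partial p_1^2}\right)^2-\frac1{12}\frac{\partial^4F}{\partial p_1^4}$).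
   Formalization: The constants i_n are assumed to be nonzero for all n ≥ 1; otherwise the rescaling divides by zero, and the claim can fail, e.g. for I_G = q_1^{|V(G)|}, where i_n = 0 for n ≥ 2. *)

theory Defs
  imports
    "HOL-Library.Poly_Mapping"
    "HOL-Library.Product_Plus"
    "HOL-Combinatorics.Permutations"
    "HOL-Computational_Algebra.Formal_Laurent_Series"
    "Jordan_Normal_Form.Determinant"
begin

text \<open>
  Sums and products that are only formally infinite are written with the library's
  \<open>sum'\<close> and \<open>prod'\<close>, which range over the indices with a nontrivial term
  (and return the neutral element if there are infinitely many of those).
\<close>

section \<open>Isomorphism classes of finite simple graphs\<close>

type_synonym graph = "nat set \<times> nat set set"

abbreviation verts :: "graph \<Rightarrow> nat set" where "verts \<equiv> fst"
abbreviation edges :: "graph \<Rightarrow> nat set set" where "edges \<equiv> snd"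

definition simple_graph :: "graph \<Rightarrow> bool" where
  "simple_graph G \<longleftrightarrow> finite (verts G) \<and> (\<forall>e\<in>edges G. e \<subseteq> verts G \<and> card e = 2)"

definition graph_isom :: "(nat \<Rightarrow> nat) \<Rightarrow> graph \<Rightarrow> graph \<Rightarrow> bool" where
  "graph_isom f G H \<longleftrightarrow> bij_betw f (verts G) (verts H) \<and> (`) f ` edges G = edges H"

definition graph_equiv :: "graph \<Rightarrow> graph \<Rightarrow> bool" where
  "graph_equiv G H \<longleftrightarrow> simple_graph G \<and> simple_graph H \<and> (\<exists>f. graph_isom f G H)"

definition induced :: "graph \<Rightarrow> nat set \<Rightarrow> graph" where
  "induced G W = (W, {e \<in> edges G. e \<subseteq> W})"

definition disjoint_union :: "graph \<Rightarrow> graph \<Rightarrow> graph" where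
  "disjoint_union G H =
     ((\<lambda>x. 2 * x) ` verts G \<union> (\<lambda>x. 2 * x + 1) ` verts H,
      (`) (\<lambda>x. 2 * x) ` edges G \<union> (`) (\<lambda>x. 2 * x + 1) ` edges H)"

definition automorphisms :: "graph \<Rightarrow> (nat \<Rightarrow> nat) set" where
  "automorphisms G = {f. f permutes verts G \<and> (`) f ` edges G = edges G}"

definition connected_graph :: "graph \<Rightarrow> bool" where
  "connected_graph G \<longleftrightarrow> verts G \<noteq> {} \<and>
     (\<forall>u\<in>verts G. \<forall>v\<in>verts G. (u, v) \<in> {(x, y). {x, y} \<in> edges G}\<^sup>*)"

lemma simple_graph_edgeD: "simple_graph G \<Longrightarrow> e \<in> edges G \<Longrightarrow> e \<subseteq> verts G"
  by (auto simp: simple_graph_def)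

lemma graph_isom_id: "graph_isom id G G"
  by (auto simp: graph_isom_def)

lemma graph_isom_sym:
  assumes "simple_graph G" "graph_isom f G H"
  shows "graph_isom (inv_into (verts G) f) H G"
proof -
  let ?g = "inv_into (verts G) f"
  have b: "bij_betw f (verts G) (verts H)" and e: "edges H = (`) f ` edges G"
    using assms(2) by (auto simp: graph_isom_def)
  have "(`) ?g ` edges H = (\<lambda>e. ?g ` f ` e) ` edges G"
    by (simp add: e image_image)
  also have "\<dots> = (\<lambda>e. e) ` edges G"
  proof (rule image_cong[OF refl])
    fix e assume "e \<in> edges G"
    then have "e \<subseteq> verts G" using assms(1) simple_graph_edgeD by blast
    then show "?g ` f ` e = e"
      using b inv_into_image_cancel[of f "verts G" e] by (auto simp: bij_betw_def)
  qed
  finally show ?thesis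
    using bij_betw_inv_into[OF b] by (simp add: graph_isom_def)
qed

lemma graph_isom_trans:
  "graph_isom f G H \<Longrightarrow> graph_isom g H K \<Longrightarrow> graph_isom (g \<circ> f) G K"
  unfolding graph_isom_def
  by (metis (no_types, lifting) bij_betw_trans image_comp image_cong comp_apply image_image)

lemma part_equivp_graph_equiv: "part_equivp graph_equiv"
proof (rule part_equivpI)
  show "\<exists>x. graph_equiv x x"
    by (rule exI[of _ "({}, {})"])
       (auto simp: graph_equiv_def simple_graph_def intro: graph_isom_id)
  show "symp graph_equiv"
    by (rule sympI) (auto simp: graph_equiv_def dest: graph_isom_sym)
  show "transp graph_equiv"
    by (rule transpI) (auto simp: graph_equiv_def dest: graph_isom_trans)
qed

quotient_type ugraph = graph / partial: graph_equiv
  by (rule part_equivp_graph_equiv)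

lemma graph_isom_induced:
  assumes "graph_isom f G H" "simple_graph G" "W \<subseteq> verts G"
  shows "graph_isom f (induced G W) (induced H (f ` W))"
proof -
  have b: "bij_betw f (verts G) (verts H)" and e: "edges H = (`) f ` edges G"
    using assms(1) by (auto simp: graph_isom_def)
  have inj: "inj_on f (verts G)" using b by (simp add: bij_betw_def)
  have "e' \<subseteq> W \<longleftrightarrow> f ` e' \<subseteq> f ` W" if "e' \<in> edges G" for e'
    using inj_on_image_mem_iff[OF inj _ assms(3)] simple_graph_edgeD[OF assms(2) that] by blast
  then have "(`) f ` {e \<in> edges G. e \<subseteq> W} = {e \<in> edges H. e \<subseteq> f ` W}"
    unfolding e by auto
  then show ?thesis
    using inj_on_subset[OF inj assms(3)] by (simp add: graph_isom_def induced_def bij_betw_def)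
qed

lemma simple_graph_induced: "simple_graph G \<Longrightarrow> W \<subseteq> verts G \<Longrightarrow> simple_graph (induced G W)"
  by (auto simp: simple_graph_def induced_def intro: finite_subset)

lemma simple_graph_disjoint_union:
  assumes "simple_graph G" "simple_graph H"
  shows "simple_graph (disjoint_union G H)"
proof -
  have "card ((\<lambda>x::nat. 2 * x) ` e) = card e" "card ((\<lambda>x::nat. Suc (2 * x)) ` e) = card e" for e
    by (auto intro!: card_image inj_onI)
  then show ?thesis
    using assms by (fastforce simp: simple_graph_def disjoint_union_def)
qed

lemma graph_isomI_disjoint_union:
  assumes "graph_isom f G A" "graph_isom g H B" "simple_graph G" "simple_graph H"
    and h1: "\<And>x. x \<in> verts G \<Longrightarrow> h (2 * x) = 2 * f x"
    and h2: "\<And>x. x \<in> verts H \<Longrightarrow> h (2 * x + 1) = 2 * g x + 1"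
  shows "graph_isom h (disjoint_union G H) (disjoint_union A B)"
proof -
  have f: "inj_on f (verts G)" "f ` verts G = verts A" "(`) f ` edges G = edges A"
    and g: "inj_on g (verts H)" "g ` verts H = verts B" "(`) g ` edges H = edges B"
    using assms(1,2) by (auto simp: graph_isom_def bij_betw_def)
  have inj: "inj_on h (verts (disjoint_union G H))"
  proof (rule inj_onI)
    fix x y assume "x \<in> verts (disjoint_union G H)" "y \<in> verts (disjoint_union G H)"
      and hxy: "h x = h y"
    then consider a b where "x = 2 * a" "y = 2 * b" "a \<in> verts G" "b \<in> verts G"
      | a b where "x = 2 * a + 1" "y = 2 * b + 1" "a \<in> verts H" "b \<in> verts H"
      | a b where "x = 2 * a" "y = 2 * b + 1" "a \<in> verts G" "b \<in> verts H"
      | a b where "x = 2 * a + 1" "y = 2 * b" "a \<in> verts H" "b \<in> verts G"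
      by (auto simp: disjoint_union_def)
    then show "x = y"
    proof cases
      case 1 then show ?thesis using hxy h1 f(1) by (auto dest: inj_onD)
    next
      case 2 then show ?thesis using hxy h2 g(1) by (auto dest: inj_onD)
    next
      case 3
      then have "2 * f a = 2 * g b + 1" using hxy h1 h2 by metis
      then show ?thesis by presburger
    next
      case 4
      then have "2 * f b = 2 * g a + 1" using hxy h1 h2 by metis
      then show ?thesis by presburger
    qed
  qed
  have im1: "h ` (\<lambda>x. 2 * x) ` e = (\<lambda>x. 2 * x) ` f ` e" if "e \<subseteq> verts G" for e
    using that h1 by (force simp: image_image intro!: image_cong)
  have im2: "h ` (\<lambda>x. 2 * x + 1) ` e = (\<lambda>x. 2 * x + 1) ` g ` e" if "e \<subseteq> verts H" for e
    unfolding image_image using that h2 by (intro image_cong) auto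
  have V: "h ` verts (disjoint_union G H) = verts (disjoint_union A B)"
    using im1[OF order_refl] im2[OF order_refl] f(2) g(2)
    by (simp add: disjoint_union_def image_Un)
  have e1: "(`) h ` (`) (\<lambda>x. 2 * x) ` edges G = (`) (\<lambda>x. 2 * x) ` edges A"
  proof -
    have "(`) h ` (`) (\<lambda>x. 2 * x) ` edges G = (\<lambda>e. h ` (\<lambda>x. 2 * x) ` e) ` edges G"
      by (rule image_image)
    also have "\<dots> = (\<lambda>e. (\<lambda>x. 2 * x) ` f ` e) ` edges G"
      by (rule image_cong[OF refl]) (rule im1[OF simple_graph_edgeD[OF assms(3)]])
    also have "\<dots> = (`) (\<lambda>x. 2 * x) ` (`) f ` edges G"
      by (rule image_image[symmetric])
    finally show ?thesis by (simp only: f(3))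
  qed
  have e2: "(`) h ` (`) (\<lambda>x. 2 * x + 1) ` edges H = (`) (\<lambda>x. 2 * x + 1) ` edges B"
  proof -
    have "(`) h ` (`) (\<lambda>x. 2 * x + 1) ` edges H = (\<lambda>e. h ` (\<lambda>x. 2 * x + 1) ` e) ` edges H"
      by (rule image_image)
    also have "\<dots> = (\<lambda>e. (\<lambda>x. 2 * x + 1) ` g ` e) ` edges H"
      by (rule image_cong[OF refl]) (rule im2[OF simple_graph_edgeD[OF assms(4)]])
    also have "\<dots> = (`) (\<lambda>x. 2 * x + 1) ` (`) g ` edges H"
      by (rule image_image[symmetric])
    finally show ?thesis by (simp only: g(3))
  qed
  have "(`) h ` edges (disjoint_union G H) = edges (disjoint_union A B)"
    using e1 e2 by (simp add: disjoint_union_def image_Un)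
  then show ?thesis
    using inj V by (simp add: graph_isom_def bij_betw_def)
qed

lemma graph_equiv_disjoint_union:
  assumes "graph_equiv G A" "graph_equiv H B"
  shows "graph_equiv (disjoint_union G H) (disjoint_union A B)"
proof -
  obtain f g where fg: "graph_isom f G A" "graph_isom g H B"
    using assms by (auto simp: graph_equiv_def)
  define h where "h x = (if even x then 2 * f (x div 2) else 2 * g (x div 2) + 1)" for x
  have "graph_isom h (disjoint_union G H) (disjoint_union A B)"
    using assms fg
    by (intro graph_isomI_disjoint_union[of f _ _ g]) (auto simp: graph_equiv_def h_def)
  then show ?thesis
    using assms by (auto simp: graph_equiv_def intro: simple_graph_disjoint_union)
qed

lemma automorphisms_card_le:
  assumes "graph_isom f G H" "simple_graph G"  "simple_graph H"
  shows "card (automorphisms G) \<le> card (automorphisms H)"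
proof -
  have b: "bij_betw f (verts G) (verts H)" and e: "edges H = (`) f ` edges G"
    using assms(1) by (auto simp: graph_isom_def)
  let ?g = "inv_into (verts G) f"
  let ?F = "\<lambda>p x. if x \<in> verts H then f (p (?g x)) else x"
  have bb: "bij_betw ?F {p. p permutes verts G} {p. p permutes verts H}"
    by (rule bij_betw_permutations[OF b])
  have edge: "?F p ` f ` d = f ` p ` d" if "d \<in> edges G" for p d
  proof -
    have "d \<subseteq> verts G" using that assms(2) simple_graph_edgeD by blast
    then show ?thesis
      using b unfolding image_image
      by (intro image_cong) (auto simp: bij_betw_def)
  qed
  have "?F p \<in> automorphisms H" if p: "p \<in> automorphisms G" for p
  proof -
    have pe: "(`) p ` edges G = edges G" and pp: "p permutes verts G"
      using p by (auto simp: automorphisms_def)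
    have "(`) (?F p) ` edges H = (\<lambda>d. ?F p ` f ` d) ` edges G"
      unfolding e by (rule image_image)
    also have "\<dots> = (\<lambda>d. f ` p ` d) ` edges G"
      by (rule image_cong[OF refl]) (rule edge)
    also have "\<dots> = (`) f ` (`) p ` edges G"
      by (rule image_image[symmetric])
    finally have "(`) (?F p) ` edges H = edges H" by (simp add: pe e)
    moreover have "?F p permutes verts H"
      using bij_betwE[OF bb] pp by auto
    ultimately show ?thesis by (simp add: automorphisms_def)
  qed
  moreover have "inj_on ?F (automorphisms G)"
    using bb by (auto simp: bij_betw_def automorphisms_def intro: inj_on_subset)
  moreover have "finite (automorphisms H)"
    using finite_permutations[of "verts H"] assms(3)
    by (auto simp: automorphisms_def simple_graph_def intro: finite_subset[rotated])
  ultimately show ?thesis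
    by (intro card_inj_on_le[of ?F]) auto
qed

lemma connected_graph_isom:
  assumes "graph_isom f G H" "connected_graph G"
  shows "connected_graph H"
proof -
  have b: "f ` verts G = verts H" and e: "edges H = (`) f ` edges G"
    using assms(1) by (auto simp: graph_isom_def bij_betw_def)
  have step: "(f u, f v) \<in> {(x, y). {x, y} \<in> edges H}\<^sup>*"
    if "(u, v) \<in> {(x, y). {x, y} \<in> edges G}\<^sup>*" for u v
    using that
  proof (induction rule: rtrancl_induct)
    case base then show ?case by simp
  next
    case (step y z)
    have "{f y, f z} = f ` {y, z}" by simp
    then have "{f y, f z} \<in> edges H" using step.hyps(2) unfolding e by blast
    then show ?case using step.IH by (auto intro: rtrancl_into_rtrancl)
  qed
  then show ?thesis
    using assms(2) by (auto simp: connected_graph_def b[symmetric])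
qed

instantiation ugraph :: comm_monoid_add
begin

lift_definition zero_ugraph :: ugraph is "({}, {})"
  by (auto simp: graph_equiv_def simple_graph_def intro: graph_isom_id)

lift_definition plus_ugraph :: "ugraph \<Rightarrow> ugraph \<Rightarrow> ugraph" is disjoint_union
  by (rule graph_equiv_disjoint_union)

instance
proof
  show "a + b + c = a + (b + c)" for a b c :: ugraph
  proof (transfer, goal_cases)
    case (1 G H K)
    then have s: "simple_graph G" "simple_graph H" "simple_graph K"
      by (auto simp: graph_equiv_def)
    define h :: "nat \<Rightarrow> nat" where
      "h x = (if odd x then 2 * x + 1 else if odd (x div 2) then x - 1 else x div 2)" for x
    have h: "h (2 * (2 * x)) = 2 * x" "h (2 * (2 * x + 1)) = 2 * (2 * x) + 1"
        "h (2 * x + 1) = 2 * (2 * x + 1) + 1" for x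
      by (auto simp: h_def)
    have "inj h"
    proof (rule injI)
      fix x y assume a: "h x = h y"
      have "\<exists>a. x = 2 * (2 * a) \<or> x = 2 * (2 * a + 1) \<or> x = 2 * a + 1" for x :: nat by presburger
      then obtain a b where "x = 2 * (2 * a) \<or> x = 2 * (2 * a + 1) \<or> x = 2 * a + 1"
        "y = 2 * (2 * b) \<or> y = 2 * (2 * b + 1) \<or> y = 2 * b + 1" by metis
      then show "x = y" using a h by (elim disjE; simp only: h; presburger)
    qed
    then have "graph_isom h (disjoint_union (disjoint_union G H) K)
        (disjoint_union G (disjoint_union H K))"
      by (auto simp: graph_isom_def disjoint_union_def image_Un image_image h[simplified]
          Un_assoc intro!: inj_on_imp_bij_betw intro: inj_on_subset simp: bij_betw_def)
    then show ?case using s by (auto simp: graph_equiv_def intro!: simple_graph_disjoint_union)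
  qed
  show "a + b = b + a" for a b :: ugraph
  proof (transfer, goal_cases)
    case (1 G H)
    then have s: "simple_graph G" "simple_graph H"
      by (auto simp: graph_equiv_def)
    define h :: "nat \<Rightarrow> nat" where "h x = (if even x then x + 1 else x - 1)" for x
    have h: "h (2 * x) = 2 * x + 1" "h (2 * x + 1) = 2 * x" for x
      by (auto simp: h_def)
    have "inj h"
    proof (rule injI)
      fix x y assume "h x = h y"
      then show "x = y" unfolding h_def by (auto split: if_splits elim!: oddE evenE) presburger+
    qed
    then have "graph_isom h (disjoint_union G H) (disjoint_union H G)"
      by (auto simp: graph_isom_def disjoint_union_def image_Un image_image h[simplified]
          intro: inj_on_subset simp: bij_betw_def)
    then show ?case using s by (auto simp: graph_equiv_def intro!: simple_graph_disjoint_union)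
  qed
  show "0 + a = a" for a :: ugraph
  proof (transfer, goal_cases)
    case (1 G)
    then have s: "simple_graph G" by (auto simp: graph_equiv_def)
    have "graph_isom (\<lambda>x. x div 2) (disjoint_union ({}, {}) G) G"
      by (auto simp: graph_isom_def disjoint_union_def bij_betw_def image_image inj_on_def)
    moreover have "simple_graph ({}, {})" by (simp add: simple_graph_def)
    ultimately show ?case
      using s by (auto simp: graph_equiv_def intro!: simple_graph_disjoint_union)
  qed
qed

end

lift_definition num_verts :: "ugraph \<Rightarrow> nat" is "\<lambda>G. card (verts G)"
  by (auto simp: graph_equiv_def graph_isom_def dest: bij_betw_same_card)

lift_definition aut_order :: "ugraph \<Rightarrow> nat" is "\<lambda>G. card (automorphisms G)"
  by (auto simp: graph_equiv_def intro!: antisym automorphisms_card_le dest: graph_isom_sym)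

lift_definition connected_ugraph :: "ugraph \<Rightarrow> bool" is connected_graph
  by (auto simp: graph_equiv_def dest: graph_isom_sym connected_graph_isom)

section \<open>Hopf algebra of graphs, polynomial Hopf algebra\<close>

text \<open>
  A vector space with basis \<^typ>\<open>'a\<close> is \<^typ>\<open>'a \<Rightarrow>\<^sub>0 complex\<close>, the basis vectors being
  \<^term>\<open>Poly_Mapping.single a 1\<close>; if \<^typ>\<open>'a\<close> is an additive monoid, the multiplication of
  \<^typ>\<open>'a \<Rightarrow>\<^sub>0 complex\<close> is the bilinear extension of the monoid operation. Tensor products
  of such spaces have the pairs of basis elements as a basis.
\<close>

type_synonym graph_algebra = "ugraph \<Rightarrow>\<^sub>0 complex"

text \<open>
  Exponent vectors of monomials. Variables are numbered from 1, exponent vectors from 0: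
  entry \<open>i\<close> is the exponent of the variable with number \<open>i + 1\<close>.
\<close>
type_synonym mon = "nat \<Rightarrow>\<^sub>0 nat"

type_synonym qpoly = "mon \<Rightarrow>\<^sub>0 complex"

definition var_mon :: "nat \<Rightarrow> mon" where
  "var_mon n = Poly_Mapping.single (n - 1) 1"

definition wdeg :: "mon \<Rightarrow> nat" where
  "wdeg m = (\<Sum>i\<in>Poly_Mapping.keys m. (i + 1) * Poly_Mapping.lookup m i)"

definition scale :: "complex \<Rightarrow> ('a \<Rightarrow>\<^sub>0 complex) \<Rightarrow> ('a \<Rightarrow>\<^sub>0 complex)" where
  "scale c x = Poly_Mapping.map ((*) c) x"

definition lin_ext :: "('a \<Rightarrow> ('b \<Rightarrow>\<^sub>0 complex)) \<Rightarrow> ('a \<Rightarrow>\<^sub>0 complex) \<Rightarrow> ('b \<Rightarrow>\<^sub>0 complex)" where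
  "lin_ext f x = (\<Sum>a\<in>Poly_Mapping.keys x. scale (Poly_Mapping.lookup x a) (f a))"

definition tensor :: "('a \<Rightarrow>\<^sub>0 complex) \<Rightarrow> ('b \<Rightarrow>\<^sub>0 complex) \<Rightarrow> ('a \<times> 'b \<Rightarrow>\<^sub>0 complex)" where
  "tensor x y = (\<Sum>a\<in>Poly_Mapping.keys x. \<Sum>b\<in>Poly_Mapping.keys y. Poly_Mapping.single (a, b) (Poly_Mapping.lookup x a * Poly_Mapping.lookup y b))"

definition tensor_map ::
  "(('a \<Rightarrow>\<^sub>0 complex) \<Rightarrow> ('c \<Rightarrow>\<^sub>0 complex)) \<Rightarrow> (('b \<Rightarrow>\<^sub>0 complex) \<Rightarrow> ('d \<Rightarrow>\<^sub>0 complex)) \<Rightarrow>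
   ('a \<times> 'b \<Rightarrow>\<^sub>0 complex) \<Rightarrow> ('c \<times> 'd \<Rightarrow>\<^sub>0 complex)" where
  "tensor_map f g =
     lin_ext (\<lambda>(a, b). tensor (f (Poly_Mapping.single a 1)) (g (Poly_Mapping.single b 1)))"

text \<open>Both counits: the basis element \<open>0\<close> is the empty graph, respectively the monomial 1.\<close>
definition counit :: "('a::zero \<Rightarrow>\<^sub>0 complex) \<Rightarrow> complex" where
  "counit x = Poly_Mapping.lookup x 0"

definition graded_part :: "('a \<Rightarrow> nat) \<Rightarrow> nat \<Rightarrow> ('a \<Rightarrow>\<^sub>0 complex) set" where
  "graded_part deg n = {x. \<forall>a\<in>Poly_Mapping.keys x. deg a = n}"

lift_definition graph_coprod_basis :: "ugraph \<Rightarrow> (ugraph \<times> ugraph \<Rightarrow>\<^sub>0 complex)" is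
  "\<lambda>G. \<Sum>W\<in>Pow (verts G). Poly_Mapping.single
         (abs_ugraph (induced G W), abs_ugraph (induced G (verts G - W))) 1"
proof -
  fix G H assume "graph_equiv G H"
  then obtain f where s: "simple_graph G" "simple_graph H" and f: "graph_isom f G H"
    by (auto simp: graph_equiv_def)
  have b: "bij_betw f (verts G) (verts H)" using f by (simp add: graph_isom_def)
  have eq: "abs_ugraph (induced G W) = abs_ugraph (induced H (f ` W))" if "W \<subseteq> verts G" for W
  proof -
    have "f ` W \<subseteq> verts H" using that b by (auto simp: bij_betw_def)
    then have "graph_equiv (induced G W) (induced H (f ` W))"
      using graph_isom_induced[OF f s(1) that] s that
      by (auto simp: graph_equiv_def intro: simple_graph_induced)
    then show ?thesis by (metis Quotient3_rel Quotient3_ugraph)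
  qed
  show "(\<Sum>W\<in>Pow (verts G). Poly_Mapping.single
         (abs_ugraph (induced G W), abs_ugraph (induced G (verts G - W))) (1::complex)) =
        (\<Sum>W\<in>Pow (verts H). Poly_Mapping.single
         (abs_ugraph (induced H W), abs_ugraph (induced H (verts H - W))) 1)"
  proof -
    have "(\<Sum>W\<in>Pow (verts G). Poly_Mapping.single
         (abs_ugraph (induced G W), abs_ugraph (induced G (verts G - W))) (1::complex)) =
      (\<Sum>W\<in>Pow (verts G). Poly_Mapping.single
         (abs_ugraph (induced H (f ` W)), abs_ugraph (induced H (verts H - f ` W))) 1)"
    proof (rule sum.cong[OF refl])
      fix W assume W: "W \<in> Pow (verts G)"
      have "verts H - f ` W = f ` (verts G - W)"
        using b W inj_on_image_set_diff[of f "verts G" "verts G" W] by (auto simp: bij_betw_def)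
      then show "Poly_Mapping.single
         (abs_ugraph (induced G W), abs_ugraph (induced G (verts G - W))) (1::complex) =
        Poly_Mapping.single
         (abs_ugraph (induced H (f ` W)), abs_ugraph (induced H (verts H - f ` W))) 1"
        using eq[of W] eq[of "verts G - W"] W by simp
    qed
    also have "\<dots> = (\<Sum>W\<in>Pow (verts H). Poly_Mapping.single
         (abs_ugraph (induced H W), abs_ugraph (induced H (verts H - W))) 1)"
      by (rule sum.reindex_bij_betw[OF bij_betw_Pow[OF b]])
    finally show ?thesis .
  qed
qed

definition graph_coprod :: "graph_algebra \<Rightarrow> (ugraph \<times> ugraph \<Rightarrow>\<^sub>0 complex)" where
  "graph_coprod = lin_ext graph_coprod_basis"

text \<open>The algebra homomorphism with \<open>q\<^sub>n \<mapsto> q\<^sub>n \<otimes> 1 + 1 \<otimes> q\<^sub>n\<close>.\<close>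
definition poly_coprod :: "qpoly \<Rightarrow> (mon \<times> mon \<Rightarrow>\<^sub>0 complex)" where
  "poly_coprod = lin_ext (\<lambda>m. \<Prod>i\<in>Poly_Mapping.keys m.
     (Poly_Mapping.single (var_mon (i + 1), 0) 1 +
      Poly_Mapping.single (0, var_mon (i + 1)) 1) ^ Poly_Mapping.lookup m i)"

text \<open>
  Homomorphisms of graded Hopf algebras. Compatibility with the antipodes is not listed, since
  every homomorphism of bialgebras between Hopf algebras commutes with the antipodes.
\<close>
definition umbral_invariant :: "(graph_algebra \<Rightarrow> qpoly) \<Rightarrow> bool" where
  "umbral_invariant I \<longleftrightarrow>
     Vector_Spaces.linear scale scale I \<and>
     I 1 = 1 \<and> (\<forall>x y. I (x * y) = I x * I y) \<and>
     (\<forall>x. poly_coprod (I x) = tensor_map I I (graph_coprod x)) \<and>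
     (\<forall>x. counit (I x) = counit x) \<and>
     (\<forall>n. I ` graded_part num_verts n \<subseteq> graded_part wdeg n)"

definition graph_value :: "(graph_algebra \<Rightarrow> qpoly) \<Rightarrow> ugraph \<Rightarrow> qpoly" where
  "graph_value I G = I (Poly_Mapping.single G 1)"

section \<open>Formal power series in infinitely many variables\<close>

typedef mps = "UNIV :: (mon \<Rightarrow> complex) set"
  morphisms mcoeff Mps ..

setup_lifting type_definition_mps

lemma finite_mon_splits: "finite {(a, b). a + b = (m :: mon)}"
proof -
  let ?S = "{f. \<forall>x. (x \<in> Poly_Mapping.keys m \<longrightarrow> f x \<in> {..Max (Poly_Mapping.lookup m ` Poly_Mapping.keys m)}) \<and> (x \<notin> Poly_Mapping.keys m \<longrightarrow> f x = 0)}"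
  have "finite ?S" by (rule finite_set_of_finite_funs) auto
  moreover have "Poly_Mapping.lookup a \<in> ?S" if "a + b = m \<or> b + a = m" for a b
  proof -
    have le: "Poly_Mapping.lookup a x \<le> Poly_Mapping.lookup m x" for x using that by (auto simp: lookup_add)
    have "Poly_Mapping.lookup a x \<le> Max (Poly_Mapping.lookup m ` Poly_Mapping.keys m)" if "x \<in> Poly_Mapping.keys m" for x
      using that by (intro order_trans[OF le] Max_ge) auto
    moreover have "Poly_Mapping.lookup a x = 0" if "x \<notin> Poly_Mapping.keys m" for x
      using le[of x] that by (simp add: in_keys_iff)
    ultimately show ?thesis by auto
  qed
  ultimately have sub: "{a. \<exists>b. a + b = m \<or> b + a = m} \<subseteq> Poly_Mapping.lookup -` ?S"
    and fin: "finite ?S"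
    by blast+
  have "inj (Poly_Mapping.lookup :: mon \<Rightarrow> _)" by (simp add: inj_def)
  with fin have "finite ((Poly_Mapping.lookup :: mon \<Rightarrow> _) -` ?S)" by (rule finite_vimageI)
  then have "finite {a. \<exists>b. a + b = m \<or> b + a = m}" by (rule finite_subset[OF sub])
  then have "finite ({a. \<exists>b. a + b = m \<or> b + a = m} \<times> {a. \<exists>b. a + b = m \<or> b + a = m})" by (intro finite_cartesian_product)
  then show ?thesis by (rule finite_subset[rotated]) auto
qed

instantiation mps :: comm_ring_1
begin

lift_definition zero_mps :: mps is "\<lambda>_. 0" .
lift_definition one_mps :: mps is "\<lambda>m. if m = 0 then 1 else 0" .
lift_definition plus_mps :: "mps \<Rightarrow> mps \<Rightarrow> mps" is "\<lambda>f g m. f m + g m" .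
lift_definition minus_mps :: "mps \<Rightarrow> mps \<Rightarrow> mps" is "\<lambda>f g m. f m - g m" .
lift_definition uminus_mps :: "mps \<Rightarrow> mps" is "\<lambda>f m. - f m" .
lift_definition times_mps :: "mps \<Rightarrow> mps \<Rightarrow> mps" is
  "\<lambda>f g m. \<Sum>(a, b)\<in>{(a, b). a + b = m}. f a * g b" .

instance
proof
  fix a b c :: mps
  show "a * b * c = a * (b * c)"
  proof (transfer, rule ext)
    fix f g h :: "mon \<Rightarrow> complex" and m :: mon
    have "(\<Sum>(a, b)\<in>{(a, b). a + b = m}. (\<Sum>(c, d)\<in>{(c, d). c + d = a}. f c * g d) * h b) =
      (\<Sum>p\<in>{(a, b). a + b = m}. \<Sum>q\<in>{(c, d). c + d = fst p}. f (fst q) * g (snd q) * h (snd p))"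
      by (simp add: case_prod_unfold sum_distrib_right)
    also have "\<dots> = (\<Sum>(p, q)\<in>(SIGMA p:{(a, b). a + b = m}. {(c, d). c + d = fst p}).
        f (fst q) * g (snd q) * h (snd p))"
      by (rule sum.Sigma) (auto simp: finite_mon_splits)
    also have "\<dots> = (\<Sum>(p, q)\<in>(SIGMA p:{(a, b). a + b = m}. {(c, d). c + d = snd p}).
        f (fst p) * (g (fst q) * h (snd q)))"
      by (rule sum.reindex_bij_witness[of _
            "\<lambda>(p, q). ((fst p + fst q, snd q), (fst p, fst q))"
            "\<lambda>(p, q). ((fst q, snd q + snd p), (snd q, snd p))"])
         (auto simp: add.assoc)
    also have "\<dots> = (\<Sum>p\<in>{(a, b). a + b = m}. \<Sum>q\<in>{(c, d). c + d = snd p}.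
        f (fst p) * (g (fst q) * h (snd q)))"
      by (rule sum.Sigma[symmetric]) (auto simp: finite_mon_splits)
    also have "\<dots> = (\<Sum>(a, b)\<in>{(a, b). a + b = m}. f a * (\<Sum>(c, d)\<in>{(c, d). c + d = b}. g c * h d))"
      by (simp add: case_prod_unfold sum_distrib_left)
    finally show "(\<Sum>(a, b)\<in>{(a, b). a + b = m}. (\<Sum>(c, d)\<in>{(c, d). c + d = a}. f c * g d) * h b) =
      (\<Sum>(a, b)\<in>{(a, b). a + b = m}. f a * (\<Sum>(c, d)\<in>{(c, d). c + d = b}. g c * h d))" .
  qed
  show "a * b = b * a"
  proof (transfer, rule ext)
    fix f g :: "mon \<Rightarrow> complex" and m :: mon
    show "(\<Sum>(a, b)\<in>{(a, b). a + b = m}. f a * g b) = (\<Sum>(a, b)\<in>{(a, b). a + b = m}. g a * f b)"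
      by (rule sum.reindex_bij_witness[of _ prod.swap prod.swap]) (auto simp: add.commute)
  qed
  show "1 * a = a"
  proof (transfer, rule ext)
    fix f :: "mon \<Rightarrow> complex" and m :: mon
    have "(\<Sum>(a, b)\<in>{(a, b). a + b = m}. (if a = 0 then 1 else 0) * f b) =
      (\<Sum>(a, b)\<in>{(0 :: mon, m)}. (if a = 0 then 1 else 0) * f b)"
      by (intro sum.mono_neutral_right ballI) (auto simp: finite_mon_splits split: if_splits)
    then show "(\<Sum>(a, b)\<in>{(a, b). a + b = m}. (if a = 0 then 1 else 0) * f b) = f m" by simp
  qed
  show "(a + b) * c = a * c + b * c"
    by transfer (auto simp: case_prod_unfold sum.distrib[symmetric] algebra_simps)
qed (transfer; auto simp: fun_eq_iff intro: exI[of _ 0])+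

end

lift_definition mscale :: "complex \<Rightarrow> mps \<Rightarrow> mps" is "\<lambda>c f m. c * f m" .

text \<open>Sum of a family in which each monomial occurs in only finitely many members.\<close>
lift_definition mps_sum :: "('b \<Rightarrow> mps) \<Rightarrow> 'b set \<Rightarrow> mps" is
  "\<lambda>f A m. sum' (\<lambda>x. f x m) A" .

definition mps_of_poly :: "qpoly \<Rightarrow> mps" where
  "mps_of_poly P = Mps (Poly_Mapping.lookup P)"

lift_definition mvar :: "nat \<Rightarrow> mps" is "\<lambda>n m. if m = var_mon n then 1 else 0" .

lift_definition hom_part :: "nat \<Rightarrow> mps \<Rightarrow> mps" is
  "\<lambda>n f m. if wdeg m = n then f m else 0" .

text \<open>Substitution of \<open>a\<^sub>n p\<^sub>n\<close> for the variable with number \<open>n\<close>.\<close>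
lift_definition rescale :: "(nat \<Rightarrow> complex) \<Rightarrow> mps \<Rightarrow> mps" is
  "\<lambda>a f m. f m * (\<Prod>i\<in>Poly_Mapping.keys m. a (i + 1) ^ Poly_Mapping.lookup m i)" .

text \<open>
  Only meaningful for series without constant term; on these, \<open>mps_exp\<close> is injective, with the
  series with constant term 1 as image, and the logarithm is its inverse.
\<close>
definition mps_exp :: "mps \<Rightarrow> mps" where
  "mps_exp F = mps_sum (\<lambda>k. mscale (1 / fact k) (F ^ k)) UNIV"

definition is_mps_log :: "mps \<Rightarrow> mps \<Rightarrow> bool" where
  "is_mps_log F T \<longleftrightarrow> mcoeff F 0 = 0 \<and> mps_exp F = T"

section \<open>KP hierarchy\<close>

definition schur1 :: "int \<Rightarrow> mps" where
  "schur1 n = (if n < 0 then 0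
     else hom_part (nat n) (mps_exp (mps_sum (\<lambda>k. mscale (1 / of_nat k) (mvar k)) {1..})))"

definition is_partition :: "nat list \<Rightarrow> bool" where
  "is_partition \<mu> \<longleftrightarrow> sorted_wrt (\<ge>) \<mu> \<and> 0 \<notin> set \<mu>"

definition schur :: "nat list \<Rightarrow> mps" where
  "schur \<mu> = det (mat (length \<mu>) (length \<mu>) (\<lambda>(i, j). schur1 (int (\<mu> ! i) - int i + int j)))"

text \<open>The exponents \<open>m\<^sub>i = \<mu>\<^sub>i - i\<close> of \<open>v\<^sub>\<mu> = z\<^bsup>m\<^sub>1\<^esup> \<and> z\<^bsup>m\<^sub>2\<^esup> \<and> \<dots>\<close>, for \<open>i \<ge> 1\<close>.\<close>
definition wedge_exponent :: "nat list \<Rightarrow> nat \<Rightarrow> int" where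
  "wedge_exponent \<mu> i = (if i \<le> length \<mu> then int (\<mu> ! (i - 1)) else 0) - int i"

definition kp_frame :: "(nat \<Rightarrow> complex fls) \<Rightarrow> bool" where
  "kp_frame \<beta> \<longleftrightarrow>
     (\<forall>i\<ge>1. fls_subdegree (\<beta> i) = - int i \<and> fls_nth (\<beta> i) (- int i) = 1)"

text \<open>
  The coefficient of \<open>v\<^sub>\<mu>\<close> in \<open>\<beta>\<^sub>1 \<and> \<beta>\<^sub>2 \<and> \<dots>\<close>: one term of each \<open>\<beta>\<^sub>i\<close> is chosen, so that
  \<open>z\<^bsup>m\<^sub>1\<^esup>, z\<^bsup>m\<^sub>2\<^esup>, \<dots>\<close> occur once each, and the factors are then put in order.
\<close>
definition wedge_coeff :: "(nat \<Rightarrow> complex fls) \<Rightarrow> nat list \<Rightarrow> complex" where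
  "wedge_coeff \<beta> \<mu> =
     sum' (\<lambda>\<sigma>. of_int (sign \<sigma>) * prod' (\<lambda>i. fls_nth (\<beta> i) (wedge_exponent \<mu> (\<sigma> i))) {1..})
       {\<sigma>. permutation \<sigma> \<and> \<sigma> permutes {1..}}"

lemma wedge_coeff_vacuum:
  assumes "kp_frame \<beta>"
  shows "wedge_coeff \<beta> [] = 1"
proof -
  define t where "t \<sigma> = of_int (sign \<sigma>) *
    prod' (\<lambda>i. fls_nth (\<beta> i) (wedge_exponent [] (\<sigma> i))) {1..}" for \<sigma> :: "nat \<Rightarrow> nat"
  let ?P = "{\<sigma>::nat \<Rightarrow> nat. permutation \<sigma> \<and> \<sigma> permutes {1..}}"
  have we: "wedge_exponent [] i = - int i" if "i \<ge> 1" for i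
    using that by (simp add: wedge_exponent_def)
  have diag: "fls_nth (\<beta> i) (- int i) = 1" if "i \<ge> 1" for i
    using assms that by (simp add: kp_frame_def)
  have low: "fls_nth (\<beta> i) k = 0" if "i \<ge> 1" "k < - int i" for i k
    using assms that by (intro fls_eq0_below_subdegree) (simp add: kp_frame_def)
  have zero: "t \<sigma> = 0" if s: "\<sigma> \<in> ?P" and ne: "\<sigma> \<noteq> id" for \<sigma>
  proof -
    let ?e = "\<lambda>i. fls_nth (\<beta> i) (wedge_exponent [] (\<sigma> i))"
    let ?S = "{i. \<sigma> i \<noteq> i}"
    have fin: "finite ?S" and bij: "bij \<sigma>" and perm: "\<sigma> permutes {1..}"
      using s by (auto simp: permutation)
    have "?S \<noteq> {}" using ne by (auto simp: fun_eq_iff)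
    then have j: "Max ?S \<in> ?S" using fin Max_in by blast
    obtain i where i: "\<sigma> i = Max ?S" using bij by (metis bij_pointE)
    have "i \<in> ?S" using i j by auto
    then have "i < Max ?S"
      using Max_ge[OF fin] i by (metis (mono_tags, lifting) le_neq_implies_less mem_Collect_eq)
    moreover have "i \<ge> 1" using perm \<open>i \<in> ?S\<close> by (auto simp: permutes_def)
    ultimately have i0: "?e i = 0" using low[of i] we[of "\<sigma> i"] i by simp
    have "{i\<in>{1..}. ?e i \<noteq> 1} \<subseteq> ?S" using we diag by auto
    then have "finite {i\<in>{1..}. ?e i \<noteq> 1}" using fin finite_subset by blast
    then have "prod' ?e {1..} = 0"
      using i0 \<open>i \<ge> 1\<close> by (auto simp: prod.G_def intro!: prod_zero)
    then show ?thesis by (simp add: t_def)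
  qed
  have "{i\<in>{1..}. fls_nth (\<beta> i) (wedge_exponent [] (id i)) \<noteq> 1} = {}"
    using we diag by auto
  then have one: "t id = 1" by (auto simp: t_def prod.G_def sign_id)
  have "id \<in> ?P" by (simp add: permutes_id)
  then have "{\<sigma>\<in>?P. t \<sigma> \<noteq> 0} = {id}" using zero one by auto
  then have "sum' t ?P = 1" using one by (simp add: sum.G_def)
  then show ?thesis unfolding wedge_coeff_def t_def .
qed

text \<open>
  The normalization of the vacuum coefficient holds automatically by
  \<open>wedge_coeff_vacuum\<close>.
\<close>
definition kp_tau :: "mps \<Rightarrow> bool" where
  "kp_tau T \<longleftrightarrow> (\<exists>\<beta>. kp_frame \<beta> \<and>
     T = mps_sum (\<lambda>\<mu>. mscale (wedge_coeff \<beta> \<mu>) (schur \<mu>)) {\<mu>. is_partition \<mu>})"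

definition kp_solution :: "mps \<Rightarrow> bool" where
  "kp_solution F \<longleftrightarrow> (\<exists>T. kp_tau T \<and> is_mps_log F T)"

section \<open>Generating functions\<close>

definition gf_all :: "(graph_algebra \<Rightarrow> qpoly) \<Rightarrow> mps" where
  "gf_all I = mps_sum (\<lambda>G. mscale (1 / of_nat (aut_order G)) (mps_of_poly (graph_value I G))) UNIV"

definition gf_connected :: "(graph_algebra \<Rightarrow> qpoly) \<Rightarrow> mps" where
  "gf_connected I = mps_sum (\<lambda>G. mscale (1 / of_nat (aut_order G)) (mps_of_poly (graph_value I G)))
     {G. connected_ugraph G}"

definition rescaling_const :: "(graph_algebra \<Rightarrow> qpoly) \<Rightarrow> nat \<Rightarrow> complex" where
  "rescaling_const I n = fact n *
     sum' (\<lambda>G. Poly_Mapping.lookup (graph_value I G) (var_mon n) / of_nat (aut_order G)) {G. connected_ugraph G}"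

end

theory Submission
  imports Defs
begin

text \<open>
  By the orbit-stabilizer theorem (\<open>sum_labelled_graphs\<close>), the part of degree \<open>n\<close> of the
  generating function of all graphs is \<open>1 / n!\<close> times the sum of the values of the invariant over
  the labelled graphs on \<open>n\<close> vertices. Two facts about labelled graphs then carry the proof.

  The coproduct of a graph restricts it to \<open>W\<close> and to \<open>V - W\<close>. The labelled graphs on
  \<open>V\<close> with given restrictions differ in the edges between \<open>W\<close> and \<open>V - W\<close>, so with
  \<open>k\<close> and \<open>l\<close> elements in \<open>W\<close> and \<open>V - W\<close> there are \<open>2\<^bsup>C(k+l,2) - C(k,2) - C(l,2)\<^esup>\<close> of
  them. Since the invariant is a homomorphism of coalgebras, dividing the part of degree \<open>n\<close> by
  \<open>2\<^bsup>C(n,2)\<^esup>\<close> for all \<open>n\<close> thus makes the generating function group-like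
  (\<open>gf_all_group_like\<close>), that is, the exponential of a linear form in the variables. The
  coefficients of this form are \<open>i\<^sub>n / (n! 2\<^bsup>C(n,2)\<^esup>)\<close>, and the rescaling is the one that turns it
  into the sum of \<open>p\<^sub>n / n\<close>. The group-like series becomes \<open>\<Sum>\<^sub>n s\<^sub>n\<close>, and the generating
  function of all graphs becomes \<open>\<Sum>\<^sub>n 2\<^bsup>C(n,2)\<^esup> s\<^sub>n\<close>.

  Every series \<open>\<Sum>\<^sub>n c\<^sub>n s\<^sub>n\<close> with \<open>c\<^sub>0 = 1\<close> is a \<open>\<tau>\<close>-function: it belongs to the wedge product
  of \<open>\<Sum>\<^sub>n c\<^sub>n z\<^bsup>n-1\<^esup>\<close> with \<open>z\<^bsup>-2\<^esup>, z\<^bsup>-3\<^esup>, \<dots>\<close> (\<open>kp_tau_one_part\<close>).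

  Splitting off the component of a vertex expresses the generating function of all graphs as the
  exponential of that of the connected graphs, because the invariant is multiplicative. This is
  proved in the form of the differential equation \<open>euler_deriv_gf_all\<close>, which is compatible with
  the rescaling and characterizes the exponential (\<open>mps_exp_unique\<close>).
\<close>

section \<open>Monomials and their weighted degree\<close>

abbreviation lookup :: "('a \<Rightarrow>\<^sub>0 'b::zero) \<Rightarrow> 'a \<Rightarrow> 'b" where
  "lookup \<equiv> Poly_Mapping.lookup"

abbreviation keys :: "('a \<Rightarrow>\<^sub>0 'b::zero) \<Rightarrow> 'a set" where
  "keys \<equiv> Poly_Mapping.keys"

lemma lookup_var_mon: "lookup (var_mon (Suc j)) i = (if i = j then 1 else 0)"
  by (simp add: var_mon_def lookup_single when_def)

lemma keys_var_mon: "keys (var_mon (Suc j)) = {j}"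
  by (simp add: var_mon_def)

lemma var_mon_inject: "var_mon (Suc j) = var_mon (Suc k) \<longleftrightarrow> j = k"
  using keys_var_mon by (metis singleton_inject)

lemma var_mon_neq_0: "var_mon n \<noteq> 0"
  unfolding var_mon_def by (metis keys_single keys_zero insert_not_empty one_neq_zero)

lemma prod_keys_mono:
  assumes "finite S" "keys m \<subseteq> S" "\<And>i. g i 0 = 1"
  shows "(\<Prod>i\<in>keys m. g i (lookup m i)) = (\<Prod>i\<in>S. g i (lookup m i))"
  using assms by (intro prod.mono_neutral_left) (auto simp: in_keys_iff)

lemma prod_keys_add:
  assumes "\<And>i. g i 0 = 1" "\<And>i k l. g i (k + l) = g i k * g i l"
  shows "(\<Prod>i\<in>keys (a + b). g i (lookup (a + b) i)) =
    (\<Prod>i\<in>keys a. g i (lookup a i)) * (\<Prod>i\<in>keys b. g i (lookup b i))"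
proof -
  have "keys (a + b) \<subseteq> keys a \<union> keys b" by (rule keys_add)
  then have "(\<Prod>i\<in>keys (a + b). g i (lookup (a + b) i)) =
      (\<Prod>i\<in>keys a \<union> keys b. g i (lookup (a + b) i))"
    using assms(1) by (intro prod_keys_mono) auto
  also have "\<dots> = (\<Prod>i\<in>keys a \<union> keys b. g i (lookup a i)) * (\<Prod>i\<in>keys a \<union> keys b. g i (lookup b i))"
    by (simp add: lookup_add assms(2) prod.distrib)
  also have "(\<Prod>i\<in>keys a \<union> keys b. g i (lookup a i)) = (\<Prod>i\<in>keys a. g i (lookup a i))"
    using assms(1) by (intro prod_keys_mono[symmetric]) auto
  also have "(\<Prod>i\<in>keys a \<union> keys b. g i (lookup b i)) = (\<Prod>i\<in>keys b. g i (lookup b i))"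
    using assms(1) by (intro prod_keys_mono[symmetric]) auto
  finally show ?thesis .
qed

lemma wdeg_superset:
  assumes "finite S" "keys m \<subseteq> S"
  shows "wdeg m = (\<Sum>i\<in>S. (i + 1) * lookup m i)"
  unfolding wdeg_def using assms by (intro sum.mono_neutral_left) (auto simp: in_keys_iff)

lemma wdeg_add: "wdeg (a + b) = wdeg a + wdeg b"
proof -
  have "keys (a + b) \<subseteq> keys a \<union> keys b" by (rule keys_add)
  then have "wdeg (a + b) = (\<Sum>i\<in>keys a \<union> keys b. (i + 1) * lookup (a + b) i)"
    by (intro wdeg_superset) auto
  also have "\<dots> = (\<Sum>i\<in>keys a \<union> keys b. (i + 1) * lookup a i) + (\<Sum>i\<in>keys a \<union> keys b. (i + 1) * lookup b i)"
    by (simp only: lookup_add add_mult_distrib2 sum.distrib)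
  also have "(\<Sum>i\<in>keys a \<union> keys b. (i + 1) * lookup a i) = wdeg a"
    by (rule wdeg_superset[symmetric]) auto
  also have "(\<Sum>i\<in>keys a \<union> keys b. (i + 1) * lookup b i) = wdeg b"
    by (rule wdeg_superset[symmetric]) auto
  finally show ?thesis .
qed

lemma wdeg_0 [simp]: "wdeg 0 = 0"
  by (simp add: wdeg_def)

lemma wdeg_eq_0_iff: "wdeg m = 0 \<longleftrightarrow> m = 0"
  by (auto simp: wdeg_def in_keys_iff poly_mapping_eq_iff fun_eq_iff)

lemma wdeg_var_mon: "wdeg (var_mon (Suc j)) = Suc j"
  by (simp add: wdeg_def keys_var_mon lookup_var_mon)

lemma var_mon_add_minus:
  assumes "lookup m j \<noteq> 0"
  shows "var_mon (Suc j) + (m - var_mon (Suc j)) = m"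
  using assms
  by (auto simp: poly_mapping_eq_iff fun_eq_iff lookup_add lookup_minus lookup_var_mon)

lemma mon_split_var:
  assumes "m \<noteq> (0 :: mon)"
  obtains j m' where "m = var_mon (Suc j) + m'" "wdeg m' < wdeg m"
proof -
  obtain j where j: "lookup m j \<noteq> 0"
    using assms by (auto simp: poly_mapping_eq_iff fun_eq_iff)
  define m' where "m' = m - var_mon (Suc j)"
  have "m = var_mon (Suc j) + m'"
    using var_mon_add_minus[OF j] by (simp add: m'_def)
  then show ?thesis
    by (intro that[of j m']) (auto simp: wdeg_add wdeg_var_mon)
qed

lemma mon_induct [case_names zero add]:
  assumes "P (0 :: mon)" "\<And>j m. P m \<Longrightarrow> P (var_mon (Suc j) + m)"
  shows "P m"
proof (induction "wdeg m" arbitrary: m rule: less_induct)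
  case less
  show ?case
  proof (cases "m = 0")
    case False
    then show ?thesis using less assms(2) by (metis mon_split_var)
  qed (use assms(1) in simp)
qed

text \<open>The product of the factorials of the exponents.\<close>
definition mon_fact :: "mon \<Rightarrow> complex" where
  "mon_fact m = (\<Prod>i\<in>keys m. fact (lookup m i))"

lemma mon_fact_nonzero: "mon_fact m \<noteq> 0"
  by (simp add: mon_fact_def)

lemma mon_fact_0 [simp]: "mon_fact 0 = 1"
  by (simp add: mon_fact_def)

lemma mon_fact_var_mon: "mon_fact (var_mon (Suc j)) = 1"
  by (simp add: mon_fact_def keys_var_mon lookup_var_mon)

lemma mon_fact_add_var: "mon_fact (var_mon (Suc j) + m) = of_nat (lookup m j + 1) * mon_fact m"
proof -
  have k: "keys (var_mon (Suc j) + m) = insert j (keys m)"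
    by (auto simp: in_keys_iff lookup_add lookup_var_mon split: if_splits)
  have "mon_fact (var_mon (Suc j) + m) =
      fact (lookup m j + 1) * (\<Prod>i\<in>keys m - {j}. fact (lookup m i))"
    unfolding mon_fact_def k
    by (subst prod.insert_remove) (auto simp: lookup_add lookup_var_mon intro!: prod.cong)
  moreover have "mon_fact m = fact (lookup m j) * (\<Prod>i\<in>keys m - {j}. fact (lookup m i))"
    unfolding mon_fact_def
    by (cases "j \<in> keys m") (auto simp: prod.remove in_keys_iff)
  ultimately show ?thesis by (simp add: algebra_simps)
qed

section \<open>Exponentials of formal power series\<close>

text \<open>The factorizations of a monomial into two monomials.\<close>
abbreviation splits :: "mon \<Rightarrow> (mon \<times> mon) set" where
  "splits m \<equiv> {(a, b). a + b = m}"

lemma mps_eqI: "(\<And>m. mcoeff F m = mcoeff G m) \<Longrightarrow> F = G"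
  by (metis ext mcoeff_inject)

lemma mcoeff_times: "mcoeff (F * G) m = (\<Sum>(a, b)\<in>splits m. mcoeff F a * mcoeff G b)"
  by (simp add: times_mps.rep_eq)

lemma mcoeff_sum: "mcoeff (sum f A) m = (\<Sum>x\<in>A. mcoeff (f x) m)"
  by (induction A rule: infinite_finite_induct) (auto simp: zero_mps.rep_eq plus_mps.rep_eq)

lemma mcoeff_mps_sum: "mcoeff (mps_sum f A) m = sum' (\<lambda>x. mcoeff (f x) m) A"
  by (simp add: mps_sum.rep_eq)

lemma mcoeff_mscale: "mcoeff (mscale c F) m = c * mcoeff F m"
  by (simp add: mscale.rep_eq)

lemma mcoeff_one: "mcoeff 1 m = (if m = 0 then 1 else 0)"
  by (simp add: one_mps.rep_eq)

lemma sum'_eq_sum: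
  assumes "finite S" "S \<subseteq> A" "\<And>x. x \<in> A - S \<Longrightarrow> f x = (0 :: 'b::comm_monoid_add)"
  shows "sum' f A = sum f S"
  using sum.mono_neutral_right'[of S A f] assms by simp

lemma mcoeff_power_eq_0:
  assumes "mcoeff F 0 = 0" "wdeg m < k"
  shows "mcoeff (F ^ k) m = 0"
  using assms(2)
proof (induction k arbitrary: m)
  case (Suc k)
  have "mcoeff F a * mcoeff (F ^ k) b = 0" if "a + b = m" for a b
  proof (cases "a = 0")
    case False
    then have "wdeg a > 0" using wdeg_eq_0_iff by blast
    then have "wdeg b < k" using that Suc.prems by (auto simp: wdeg_add)
    then show ?thesis using Suc.IH by simp
  qed (use assms(1) in simp)
  then show ?case by (auto simp: mcoeff_times intro!: sum.neutral)
qed simp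

lemma mcoeff_mps_exp:
  assumes "mcoeff F 0 = 0" "wdeg m \<le> N"
  shows "mcoeff (mps_exp F) m = mcoeff (\<Sum>k\<le>N. mscale (1 / fact k) (F ^ k)) m"
  unfolding mps_exp_def mcoeff_mps_sum mcoeff_sum
  using assms by (intro sum'_eq_sum) (auto simp: mcoeff_mscale mcoeff_power_eq_0)

text \<open>
  The derivation multiplying each monomial by its weighted degree. It turns the exponential
  into a recursion on coefficients.
\<close>
lift_definition euler_deriv :: "mps \<Rightarrow> mps" is "\<lambda>f m. of_nat (wdeg m) * f m" .

lemma mcoeff_euler_deriv: "mcoeff (euler_deriv F) m = of_nat (wdeg m) * mcoeff F m"
  by (simp add: euler_deriv.rep_eq)

lemma euler_deriv_times: "euler_deriv (F * G) = euler_deriv F * G + F * euler_deriv G"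
proof (rule mps_eqI)
  fix m
  have "of_nat (wdeg m) * (\<Sum>(a, b)\<in>splits m. mcoeff F a * mcoeff G b) =
      (\<Sum>(a, b)\<in>splits m. of_nat (wdeg a) * mcoeff F a * mcoeff G b
        + mcoeff F a * (of_nat (wdeg b) * mcoeff G b))"
    unfolding sum_distrib_left by (intro sum.cong) (auto simp: wdeg_add algebra_simps)
  then show "mcoeff (euler_deriv (F * G)) m = mcoeff (euler_deriv F * G + F * euler_deriv G) m"
    by (simp add: plus_mps.rep_eq mcoeff_times mcoeff_euler_deriv case_prod_unfold sum.distrib)
qed

lemma euler_deriv_power: "euler_deriv (F ^ Suc k) = of_nat (Suc k) * (euler_deriv F * F ^ k)"
proof (induction k)
  case 0
  then show ?case by simp
next
  case (Suc k)
  have "euler_deriv (F ^ Suc (Suc k)) = euler_deriv F * F ^ Suc k + F * euler_deriv (F ^ Suc k)"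
    using euler_deriv_times by simp
  then show ?case unfolding Suc.IH by (simp add: algebra_simps)
qed

lemma mcoeff_of_nat_times: "mcoeff (of_nat k * F) m = of_nat k * mcoeff F m"
  by (induction k) (auto simp: zero_mps.rep_eq plus_mps.rep_eq algebra_simps)

lemma euler_deriv_truncated_exp:
  "euler_deriv (\<Sum>k\<le>Suc N. mscale (1 / fact k) (F ^ k)) =
   euler_deriv F * (\<Sum>k\<le>N. mscale (1 / fact k) (F ^ k))"
proof (rule mps_eqI)
  fix m
  have "mcoeff (euler_deriv (\<Sum>k\<le>Suc N. mscale (1 / fact k) (F ^ k))) m =
      (\<Sum>k\<le>Suc N. mcoeff (euler_deriv (F ^ k)) m / fact k)"
    unfolding mcoeff_euler_deriv mcoeff_sum mcoeff_mscale sum_distrib_left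
    by (intro sum.cong refl) simp
  also have "\<dots> = (\<Sum>k\<le>N. mcoeff (euler_deriv (F ^ Suc k)) m / fact (Suc k))"
    by (subst sum.atMost_Suc_shift) (auto simp: mcoeff_euler_deriv mcoeff_one)
  also have "\<dots> = (\<Sum>k\<le>N. mcoeff (euler_deriv F * F ^ k) m / fact k)"
    unfolding euler_deriv_power mcoeff_of_nat_times
    by (intro sum.cong refl) (simp add: divide_simps del: of_nat_Suc)
  also have "\<dots> = mcoeff (euler_deriv F * (\<Sum>k\<le>N. mscale (1 / fact k) (F ^ k))) m"
    unfolding mcoeff_times mcoeff_sum mcoeff_mscale case_prod_unfold sum_distrib_left sum_divide_distrib
    by simp
  finally show "mcoeff (euler_deriv (\<Sum>k\<le>Suc N. mscale (1 / fact k) (F ^ k))) m =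
    mcoeff (euler_deriv F * (\<Sum>k\<le>N. mscale (1 / fact k) (F ^ k))) m" .
qed

lemma mcoeff_mps_exp_0:
  assumes "mcoeff F 0 = 0"
  shows "mcoeff (mps_exp F) 0 = 1"
  using mcoeff_mps_exp[OF assms, of 0 0] by (simp add: mcoeff_mscale mcoeff_one)

lemma euler_deriv_mps_exp:
  assumes "mcoeff F 0 = 0"
  shows "euler_deriv (mps_exp F) = euler_deriv F * mps_exp F"
proof (rule mps_eqI)
  fix m
  define E where "E N = (\<Sum>k\<le>N. mscale (1 / fact k) (F ^ k))" for N
  have E: "mcoeff (mps_exp F) n = mcoeff (E N) n" if "wdeg n \<le> N" for n N
    unfolding E_def by (rule mcoeff_mps_exp[OF assms that])
  have "mcoeff (euler_deriv (mps_exp F)) m = mcoeff (euler_deriv (E (Suc (wdeg m)))) m"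
    using E[of m "Suc (wdeg m)"] by (simp add: mcoeff_euler_deriv)
  also have "\<dots> = mcoeff (euler_deriv F * E (wdeg m)) m"
    unfolding E_def euler_deriv_truncated_exp ..
  also have "\<dots> = mcoeff (euler_deriv F * mps_exp F) m"
    unfolding mcoeff_times
  proof (intro sum.cong refl, clarify)
    fix a b assume "m = a + b"
    then show "mcoeff (euler_deriv F) a * mcoeff (E (wdeg (a + b))) b =
        mcoeff (euler_deriv F) a * mcoeff (mps_exp F) b"
      by (simp add: E[of b "wdeg (a + b)"] wdeg_add)
  qed
  finally show "mcoeff (euler_deriv (mps_exp F)) m = mcoeff (euler_deriv F * mps_exp F) m" .
qed

text \<open>
  The equation determines the coefficients of \<open>T\<close> recursively, since the factor \<open>euler_deriv F\<close>
  has no constant term.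
\<close>
lemma mps_exp_unique:
  assumes F: "mcoeff F 0 = 0" and T0: "mcoeff T 0 = 1"
    and T: "euler_deriv T = euler_deriv F * T"
  shows "mps_exp F = T"
proof (rule mps_eqI)
  fix m
  show "mcoeff (mps_exp F) m = mcoeff T m"
  proof (induction "wdeg m" arbitrary: m rule: less_induct)
    case less
    show ?case
    proof (cases "m = 0")
      case True
      then show ?thesis using T0 mcoeff_mps_exp_0[OF F] by simp
    next
      case False
      have "mcoeff (euler_deriv F * mps_exp F) m = mcoeff (euler_deriv F * T) m"
        unfolding mcoeff_times
      proof (intro sum.cong refl, clarify)
        fix a b assume "m = a + b"
        then show "mcoeff (euler_deriv F) a * mcoeff (mps_exp F) b =
          mcoeff (euler_deriv F) a * mcoeff T b"
          using less[of b] wdeg_eq_0_iff[of a]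
          by (cases "a = 0") (auto simp: wdeg_add mcoeff_euler_deriv)
      qed
      then have "mcoeff (euler_deriv (mps_exp F)) m = mcoeff (euler_deriv T) m"
        by (simp add: T euler_deriv_mps_exp[OF F])
      then show ?thesis
        using False by (simp add: mcoeff_euler_deriv wdeg_eq_0_iff)
    qed
  qed
qed

lemma mcoeff_rescale:
  "mcoeff (rescale a F) m = mcoeff F m * (\<Prod>i\<in>keys m. a (i + 1) ^ lookup m i)"
  by (simp add: rescale.rep_eq)

lemma rescale_times: "rescale a (F * G) = rescale a F * rescale a G"
proof (rule mps_eqI)
  fix m
  show "mcoeff (rescale a (F * G)) m = mcoeff (rescale a F * rescale a G) m"
    unfolding mcoeff_rescale mcoeff_times sum_distrib_right
  proof (intro sum.cong refl, clarify)
    fix b c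
    show "mcoeff F b * mcoeff G c * (\<Prod>i\<in>keys (b + c). a (i + 1) ^ lookup (b + c) i) =
      mcoeff F b * (\<Prod>i\<in>keys b. a (i + 1) ^ lookup b i) *
      (mcoeff G c * (\<Prod>i\<in>keys c. a (i + 1) ^ lookup c i))"
      using prod_keys_add[of "\<lambda>i k. a (i + 1) ^ k" b c] by (simp add: power_add)
  qed
qed

lemma euler_deriv_rescale: "euler_deriv (rescale a F) = rescale a (euler_deriv F)"
  by (rule mps_eqI) (simp add: mcoeff_rescale mcoeff_euler_deriv)

text \<open>
  Here \<open>F = \<Sum>\<^sub>n p\<^sub>n / n\<close>, so that \<open>euler_deriv F = \<Sum>\<^sub>n p\<^sub>n\<close>; multiplication by \<open>p\<^sub>n\<close> shifts
  the coefficients.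
\<close>
lemma mcoeff_euler_deriv_linear_times:
  assumes F: "\<And>m. mcoeff F m = (if \<exists>j. m = var_mon (Suc j) then 1 / of_nat (wdeg m) else 0)"
  shows "mcoeff (euler_deriv F * T) m = (\<Sum>j\<in>keys m. mcoeff T (m - var_mon (Suc j)))"
proof -
  have "mcoeff (euler_deriv F * T) m =
      (\<Sum>(a, b)\<in>(\<lambda>j. (var_mon (Suc j), m - var_mon (Suc j))) ` keys m. mcoeff (euler_deriv F) a * mcoeff T b)"
    unfolding mcoeff_times
  proof (rule sum.mono_neutral_right)
    show "(\<lambda>j. (var_mon (Suc j), m - var_mon (Suc j))) ` keys m \<subseteq> splits m"
      by (auto simp: var_mon_add_minus in_keys_iff)
    have "(var_mon (Suc j), b) \<in> (\<lambda>j. (var_mon (Suc j), m - var_mon (Suc j))) ` keys m"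
      if "m = var_mon (Suc j) + b" for j b
      by (rule image_eqI[of _ _ j]) (auto simp: that in_keys_iff lookup_add lookup_var_mon)
    then show "\<forall>p\<in>splits m - (\<lambda>j. (var_mon (Suc j), m - var_mon (Suc j))) ` keys m.
        (case p of (a, b) \<Rightarrow> mcoeff (euler_deriv F) a * mcoeff T b) = 0"
      by (auto simp: mcoeff_euler_deriv F split: if_splits)
  qed (rule finite_mon_splits)
  also have "\<dots> = (\<Sum>j\<in>keys m. mcoeff (euler_deriv F) (var_mon (Suc j)) * mcoeff T (m - var_mon (Suc j)))"
    by (subst sum.reindex) (auto simp: inj_on_def var_mon_inject)
  also have "\<dots> = (\<Sum>j\<in>keys m. mcoeff T (m - var_mon (Suc j)))"
    by (intro sum.cong) (auto simp: mcoeff_euler_deriv F wdeg_var_mon simp del: of_nat_Suc)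
  finally show ?thesis .
qed

section \<open>Coefficients of values of an umbral invariant\<close>

lemma lookup_scale: "lookup (scale c x) k = c * lookup x k"
  by (simp add: scale_def Poly_Mapping.map.rep_eq when_def)

lemma lookup_lin_ext_superset:
  assumes "finite S" "keys x \<subseteq> S"
  shows "lookup (lin_ext f x) k = (\<Sum>a\<in>S. lookup x a * lookup (f a) k)"
  unfolding lin_ext_def lookup_sum lookup_scale
  using assms by (intro sum.mono_neutral_left) (auto simp: in_keys_iff)

lemma lookup_lin_ext: "lookup (lin_ext f x) k = (\<Sum>a\<in>keys x. lookup x a * lookup (f a) k)"
  by (rule lookup_lin_ext_superset) auto

lemma lin_ext_add: "lin_ext f (x + y) = lin_ext f x + lin_ext f y"
proof (rule poly_mapping_eqI)
  fix k
  have "keys (x + y) \<subseteq> keys x \<union> keys y" by (rule keys_add)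
  then show "lookup (lin_ext f (x + y)) k = lookup (lin_ext f x + lin_ext f y) k"
    by (simp add: lookup_add lookup_lin_ext_superset[of "keys x \<union> keys y"] sum.distrib distrib_right)
qed

lemma lin_ext_0: "lin_ext f 0 = 0"
  by (simp add: lin_ext_def)

lemma lin_ext_sum: "lin_ext f (sum g A) = (\<Sum>x\<in>A. lin_ext f (g x))"
  by (induction A rule: infinite_finite_induct) (auto simp: lin_ext_add lin_ext_0)

lemma lin_ext_single: "lin_ext f (Poly_Mapping.single a 1) = f a"
  by (rule poly_mapping_eqI) (simp add: lookup_lin_ext)

lemma lookup_tensor: "lookup (tensor x y) (a, b) = lookup x a * lookup y b"
proof -
  have "lookup (tensor x y) (a, b) =
      (\<Sum>a'\<in>keys x. \<Sum>b'\<in>keys y. if a' = a \<and> b' = b then lookup x a * lookup y b else 0)"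
    unfolding tensor_def lookup_sum
    by (intro sum.cong refl) (auto simp: lookup_single when_def)
  also have "\<dots> = (\<Sum>a'\<in>keys x. if a' = a then \<Sum>b'\<in>keys y. if b' = b then lookup x a * lookup y b else 0 else 0)"
    by (intro sum.cong refl) (auto intro!: sum.neutral)
  also have "\<dots> = lookup x a * lookup y b"
    by (auto simp: in_keys_iff)
  finally show ?thesis .
qed

lemma lookup_times_splits:
  fixes P Q :: qpoly
  shows "lookup (P * Q) m = (\<Sum>(a, b)\<in>splits m. lookup P a * lookup Q b)"
proof -
  have "lookup (P * Q) m = prod_fun (lookup P) (lookup Q) m"
    by (simp add: times_poly_mapping.rep_eq)
  also have "\<dots> = (\<Sum>(a, b). lookup P a * lookup Q b when m = a + b)"
    by (rule prod_fun_unfold_prod) auto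
  also have "\<dots> = (\<Sum>p\<in>splits m. case p of (a, b) \<Rightarrow> lookup P a * lookup Q b when m = a + b)"
    by (rule Sum_any.expand_superset) (auto simp: finite_mon_splits)
  also have "\<dots> = (\<Sum>(a, b)\<in>splits m. lookup P a * lookup Q b)"
    by (intro sum.cong) auto
  finally show ?thesis .
qed

lemma lookup_single_times:
  fixes P :: "'a::monoid_add \<Rightarrow>\<^sub>0 complex"
  shows "lookup (Poly_Mapping.single a 1 * P) b = (\<Sum>x\<in>keys P. if a + x = b then lookup P x else 0)"
proof -
  have P: "P = (\<Sum>x\<in>keys P. Poly_Mapping.single x (lookup P x))"
    by (rule poly_mapping_eqI) (auto simp: lookup_sum lookup_single when_def in_keys_iff)
  have "lookup (Poly_Mapping.single a 1 * P) b =
      lookup (\<Sum>x\<in>keys P. Poly_Mapping.single (a + x) (lookup P x)) b"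
    by (subst P) (simp add: sum_distrib_left mult_single)
  then show ?thesis by (simp add: lookup_sum lookup_single when_def)
qed

lemma lookup_single_times_add:
  fixes P :: "'a::cancel_comm_monoid_add \<Rightarrow>\<^sub>0 complex"
  shows "lookup (Poly_Mapping.single a 1 * P) (a + b) = lookup P b"
  by (auto simp: lookup_single_times in_keys_iff)

lemma lookup_single_times_eq_0:
  fixes P :: "'a::monoid_add \<Rightarrow>\<^sub>0 complex"
  assumes "\<And>x. b \<noteq> a + x"
  shows "lookup (Poly_Mapping.single a 1 * P) b = 0"
  unfolding lookup_single_times using assms by (intro sum.neutral) metis

text \<open>The coproduct of a single monomial.\<close>
definition coprod_mon :: "mon \<Rightarrow> (mon \<times> mon \<Rightarrow>\<^sub>0 complex)" where
  "coprod_mon m = (\<Prod>i\<in>keys m.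
     (Poly_Mapping.single (var_mon (i + 1), 0) 1 +
      Poly_Mapping.single (0, var_mon (i + 1)) 1) ^ lookup m i)"

lemma coprod_mon_add: "coprod_mon (a + b) = coprod_mon a * coprod_mon b"
  unfolding coprod_mon_def
  by (rule prod_keys_add[of "\<lambda>i k. (Poly_Mapping.single (var_mon (i + 1), 0) 1 +
      Poly_Mapping.single (0, var_mon (i + 1)) 1) ^ k"]) (auto simp: power_add)

lemma coprod_mon_var:
  "coprod_mon (var_mon (Suc j)) =
   Poly_Mapping.single (var_mon (Suc j), 0) 1 + Poly_Mapping.single (0, var_mon (Suc j)) 1"
  by (simp add: coprod_mon_def keys_var_mon lookup_var_mon)

lemma lookup_single_fst_times:
  fixes P :: "mon \<times> mon \<Rightarrow>\<^sub>0 complex"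
  shows "lookup (Poly_Mapping.single (var_mon (Suc j), 0) 1 * P) (a, b) =
    (if lookup a j = 0 then 0 else lookup P (a - var_mon (Suc j), b))"
proof (cases "lookup a j = 0")
  case True
  then have ne: "(a, b) \<noteq> (var_mon (Suc j), 0) + x" for x
    by (cases x) (auto simp: lookup_add lookup_var_mon)
  then show ?thesis using True lookup_single_times_eq_0[OF ne] by simp
next
  case False
  then have "(a, b) = (var_mon (Suc j), 0) + (a - var_mon (Suc j), b)"
    by (simp add: var_mon_add_minus)
  then show ?thesis using False lookup_single_times_add by (metis (no_types))
qed

lemma lookup_single_snd_times:
  fixes P :: "mon \<times> mon \<Rightarrow>\<^sub>0 complex"
  shows "lookup (Poly_Mapping.single (0, var_mon (Suc j)) 1 * P) (a, b) =
    (if lookup b j = 0 then 0 else lookup P (a, b - var_mon (Suc j)))"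
proof (cases "lookup b j = 0")
  case True
  then have ne: "(a, b) \<noteq> (0, var_mon (Suc j)) + x" for x
    by (cases x) (auto simp: lookup_add lookup_var_mon)
  then show ?thesis using True lookup_single_times_eq_0[OF ne] by simp
next
  case False
  then have "(a, b) = (0, var_mon (Suc j)) + (a, b - var_mon (Suc j))"
    by (simp add: var_mon_add_minus)
  then show ?thesis using False lookup_single_times_add by (metis (no_types))
qed

lemma mon_fact_minus_var:
  assumes "lookup m j \<noteq> 0"
  shows "1 / mon_fact (m - var_mon (Suc j)) = of_nat (lookup m j) / mon_fact m"
proof -
  have "m = var_mon (Suc j) + (m - var_mon (Suc j))"
    using var_mon_add_minus[OF assms] by simp
  then have "mon_fact m = of_nat (lookup m j) * mon_fact (m - var_mon (Suc j))"
    using mon_fact_add_var[of j "m - var_mon (Suc j)"] assms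
    by (simp add: lookup_minus lookup_var_mon)
  then show ?thesis
    using assms mon_fact_nonzero[of m] by (auto simp: divide_simps)
qed

text \<open>
  The coefficient is the product of the binomial coefficients of the exponents; the induction over
  the variables of \<open>m\<close> is Pascal's rule.
\<close>
lemma lookup_coprod_mon:
  "lookup (coprod_mon m) (a, b) = (if a + b = m then mon_fact m / (mon_fact a * mon_fact b) else 0)"
proof (induction m arbitrary: a b rule: mon_induct)
  case zero
  have "a + b = 0 \<longleftrightarrow> a = 0 \<and> b = 0"
    by (auto simp: poly_mapping_eq_iff fun_eq_iff lookup_add)
  then show ?case
    by (auto simp: coprod_mon_def lookup_one when_def zero_prod_def)
next
  case (add j m)
  let ?v = "var_mon (Suc j)"
  have 1: "lookup (coprod_mon (?v + m)) (a, b) =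
      (if lookup a j = 0 then 0 else lookup (coprod_mon m) (a - ?v, b)) +
      (if lookup b j = 0 then 0 else lookup (coprod_mon m) (a, b - ?v))"
    by (simp add: coprod_mon_add coprod_mon_var distrib_right lookup_add
        lookup_single_fst_times lookup_single_snd_times)
  have 2: "(if lookup a j = 0 then 0 else lookup (coprod_mon m) (a - ?v, b)) =
      (if a + b = ?v + m then of_nat (lookup a j) * (mon_fact m / (mon_fact a * mon_fact b)) else 0)"
  proof (cases "lookup a j = 0")
    case False
    then have "a = ?v + (a - ?v)" by (simp add: var_mon_add_minus)
    then have "a - ?v + b = m \<longleftrightarrow> a + b = ?v + m"
      by (metis add.assoc add_left_cancel)
    then show ?thesis
      using False mon_fact_minus_var[OF False] by (simp add: add.IH mon_fact_nonzero divide_simps)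
  qed simp
  have 3: "(if lookup b j = 0 then 0 else lookup (coprod_mon m) (a, b - ?v)) =
      (if a + b = ?v + m then of_nat (lookup b j) * (mon_fact m / (mon_fact a * mon_fact b)) else 0)"
  proof (cases "lookup b j = 0")
    case False
    then have "b = ?v + (b - ?v)" by (simp add: var_mon_add_minus)
    then have "a + b = ?v + (a + (b - ?v))"
      by (metis add.left_commute)
    then have "a + (b - ?v) = m \<longleftrightarrow> a + b = ?v + m"
      by (metis add_left_cancel)
    then show ?thesis
      using False mon_fact_minus_var[OF False] by (simp add: add.IH mon_fact_nonzero divide_simps)
  qed simp
  show ?case
  proof (cases "a + b = ?v + m")
    case True
    then have "lookup a j + lookup b j = lookup m j + 1"
      by (metis add.commute lookup_add lookup_var_mon)
    then have "of_nat (lookup a j) + of_nat (lookup b j) = (of_nat (lookup m j + 1) :: complex)"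
      by (metis of_nat_add)
    then have "of_nat (lookup a j) * (mon_fact m / (mon_fact a * mon_fact b)) +
        of_nat (lookup b j) * (mon_fact m / (mon_fact a * mon_fact b)) =
        of_nat (lookup m j + 1) * (mon_fact m / (mon_fact a * mon_fact b))"
      by (metis distrib_right)
    then show ?thesis
      unfolding 1 2 3 using True by (simp add: mon_fact_add_var)
  qed (simp add: 1 2 3)
qed

lemma lookup_poly_coprod:
  "lookup (poly_coprod P) (a, b) = lookup P (a + b) * mon_fact (a + b) / (mon_fact a * mon_fact b)"
proof -
  have "poly_coprod P = lin_ext coprod_mon P"
    by (simp add: poly_coprod_def coprod_mon_def[abs_def])
  then show ?thesis
    by (simp add: lookup_lin_ext lookup_coprod_mon in_keys_iff if_distrib[of "(*) _"] cong: if_cong)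
qed

context
  fixes I :: "graph_algebra \<Rightarrow> qpoly"
  assumes I: "umbral_invariant I"
begin

lemma graph_value_0: "graph_value I 0 = 1"
  using I by (simp add: graph_value_def umbral_invariant_def)

lemma graph_value_add: "graph_value I (G + H) = graph_value I G * graph_value I H"
proof -
  have "Poly_Mapping.single (G + H) (1::complex) = Poly_Mapping.single G 1 * Poly_Mapping.single H 1"
    by (simp add: mult_single)
  then show ?thesis using I by (simp add: graph_value_def umbral_invariant_def)
qed

lemma lookup_graph_value_eq_0:
  assumes "num_verts G \<noteq> wdeg m"
  shows "lookup (graph_value I G) m = 0"
proof -
  have "Poly_Mapping.single G 1 \<in> graded_part num_verts (num_verts G)"
    by (simp add: graded_part_def)
  moreover have "I ` graded_part num_verts (num_verts G) \<subseteq> graded_part wdeg (num_verts G)"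
    using I by (simp add: umbral_invariant_def)
  ultimately have "graph_value I G \<in> graded_part wdeg (num_verts G)"
    by (auto simp: graph_value_def)
  then show ?thesis using assms unfolding graded_part_def
    by (metis (mono_tags, lifting) lookup_not_eq_zero_eq_in_keys mem_Collect_eq)
qed

text \<open>Compatibility of the invariant with the coproducts, at the basis element \<open>a \<otimes> b\<close>.\<close>
lemma graph_value_coprod:
  assumes "simple_graph G"
  shows "lookup (graph_value I (abs_ugraph G)) (a + b) * mon_fact (a + b) / (mon_fact a * mon_fact b) =
    (\<Sum>W\<in>Pow (verts G). lookup (graph_value I (abs_ugraph (induced G W))) a *
      lookup (graph_value I (abs_ugraph (induced G (verts G - W)))) b)"
proof -
  have "graph_equiv G G"
    using assms graph_isom_id[of G] unfolding graph_equiv_def by blast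
  then have "graph_coprod (Poly_Mapping.single (abs_ugraph G) 1) =
      (\<Sum>W\<in>Pow (verts G). Poly_Mapping.single
         (abs_ugraph (induced G W), abs_ugraph (induced G (verts G - W))) 1)"
    by (simp add: graph_coprod_def lin_ext_single graph_coprod_basis.abs_eq)
  then have "poly_coprod (graph_value I (abs_ugraph G)) =
      (\<Sum>W\<in>Pow (verts G). tensor (graph_value I (abs_ugraph (induced G W)))
         (graph_value I (abs_ugraph (induced G (verts G - W)))))"
    using I by (simp add: umbral_invariant_def graph_value_def tensor_map_def lin_ext_sum lin_ext_single)
  then have "lookup (poly_coprod (graph_value I (abs_ugraph G))) (a, b) =
      (\<Sum>W\<in>Pow (verts G). lookup (graph_value I (abs_ugraph (induced G W))) a *
        lookup (graph_value I (abs_ugraph (induced G (verts G - W)))) b)"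
    by (simp add: lookup_sum lookup_tensor)
  then show ?thesis by (simp add: lookup_poly_coprod)
qed

end

section \<open>Sums over labelled graphs\<close>

text \<open>
  The possible edges on the vertex set \<open>V\<close>: the labelled graphs on \<open>V\<close> are the pairs
  \<open>(V, E)\<close> with \<open>E \<subseteq> pairs V\<close>.
\<close>
definition pairs :: "nat set \<Rightarrow> nat set set" where
  "pairs V = {e. e \<subseteq> V \<and> card e = 2}"

lemma finite_pairs: "finite V \<Longrightarrow> finite (pairs V)"
  by (auto simp: pairs_def)

lemma card_pairs: "finite V \<Longrightarrow> card (pairs V) = card V choose 2"
  by (simp add: pairs_def n_subsets)

lemma pairs_mono: "W \<subseteq> V \<Longrightarrow> pairs W \<subseteq> pairs V"
  by (auto simp: pairs_def)

lemma simple_graph_iff: "simple_graph (V, E) \<longleftrightarrow> finite V \<and> E \<subseteq> pairs V"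
  by (auto simp: simple_graph_def pairs_def)

lemma induced_eq: "E \<subseteq> pairs V \<Longrightarrow> induced (V, E) W = (W, E \<inter> pairs W)"
  by (auto simp: induced_def pairs_def)

lemma graph_equiv_refl: "simple_graph G \<Longrightarrow> graph_equiv G G"
  using graph_isom_id[of G] unfolding graph_equiv_def by blast

lemma abs_ugraph_eq_iff:
  assumes "simple_graph G" "simple_graph H"
  shows "abs_ugraph G = abs_ugraph H \<longleftrightarrow> (\<exists>f. graph_isom f G H)"
  using Quotient3_rel[OF Quotient3_ugraph, of G H] assms graph_equiv_refl
  by (auto simp: graph_equiv_def)

lemma num_verts_abs: "simple_graph G \<Longrightarrow> num_verts (abs_ugraph G) = card (verts G)"
  by (simp add: num_verts.abs_eq graph_equiv_refl)

lemma aut_order_abs: "simple_graph G \<Longrightarrow> aut_order (abs_ugraph G) = card (automorphisms G)"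
  by (simp add: aut_order.abs_eq graph_equiv_refl)

lemma connected_ugraph_abs:
  "simple_graph G \<Longrightarrow> connected_ugraph (abs_ugraph G) \<longleftrightarrow> connected_graph G"
  by (simp add: connected_ugraph.abs_eq graph_equiv_refl)

lemma ugraph_on_vertices:
  assumes "finite V" "num_verts U = card V"
  obtains E where "E \<subseteq> pairs V" "U = abs_ugraph (V, E)"
proof -
  obtain G where G: "simple_graph G" "U = abs_ugraph G"
    by (induction U rule: ugraph.abs_induct) (auto simp: graph_equiv_def)
  have "card (verts G) = card V" using assms(2) G by (simp add: num_verts_abs)
  then obtain f where f: "bij_betw f (verts G) V"
    using G(1) assms(1) by (metis finite_same_card_bij simple_graph_def)
  define E where "E = (`) f ` edges G"
  have iso: "graph_isom f G (V, E)"
    using f by (simp add: graph_isom_def E_def)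
  have "E \<subseteq> pairs V"
  proof
    fix e assume "e \<in> E"
    then obtain d where d: "d \<in> edges G" "e = f ` d" by (auto simp: E_def)
    have "d \<subseteq> verts G" "card d = 2" using G(1) d by (auto simp: simple_graph_def)
    moreover have "card (f ` d) = card d"
      using f \<open>d \<subseteq> verts G\<close> by (intro card_image) (auto simp: bij_betw_def intro: inj_on_subset)
    ultimately show "e \<in> pairs V"
      using f d by (auto simp: pairs_def bij_betw_def)
  qed
  moreover have "U = abs_ugraph (V, E)"
    using iso G abs_ugraph_eq_iff[OF G(1), of "(V, E)"] assms(1) calculation by (auto simp: simple_graph_iff)
  ultimately show ?thesis using that by blast
qed

lemma num_verts_class_eq_image:
  assumes "finite V"
  shows "{U. num_verts U = card V} = (\<lambda>E. abs_ugraph (V, E)) ` Pow (pairs V)"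
proof
  show "{U. num_verts U = card V} \<subseteq> (\<lambda>E. abs_ugraph (V, E)) ` Pow (pairs V)"
    using ugraph_on_vertices[OF assms] by blast
  show "(\<lambda>E. abs_ugraph (V, E)) ` Pow (pairs V) \<subseteq> {U. num_verts U = card V}"
    using assms by (auto simp: num_verts_abs simple_graph_iff)
qed

lemma finite_num_verts_class: "finite {U. num_verts U = n}"
  using num_verts_class_eq_image[of "{..<n}"] finite_pairs[of "{..<n}"] by simp

lemma image_pairs_permutes:
  assumes "p permutes V" "E \<subseteq> pairs V"
  shows "(`) p ` E \<subseteq> pairs V"
proof -
  have "card (p ` e) = card e" for e
    using assms(1) by (intro card_image) (metis inj_on_subset permutes_inj subset_UNIV)
  moreover have "p ` e \<subseteq> V" if "e \<subseteq> V" for e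
    using assms(1) that permutes_image by blast
  ultimately show ?thesis using assms(2) by (auto simp: pairs_def)
qed

text \<open>Orbits and stabilizers of the symmetric group of \<open>V\<close> acting on the graphs with vertex set \<open>V\<close>.\<close>
lemma card_labellings:
  assumes V: "finite V" and E0: "E0 \<subseteq> pairs V"
  shows "card {E \<in> Pow (pairs V). abs_ugraph (V, E) = abs_ugraph (V, E0)} *
    card (automorphisms (V, E0)) = fact (card V)"
proof -
  let ?P = "{p. p permutes V}"
  let ?O = "{E \<in> Pow (pairs V). abs_ugraph (V, E) = abs_ugraph (V, E0)}"
  let ?act = "\<lambda>p E. (`) p ` E :: nat set set"
  have comp: "?act p (?act q E) = ?act (p \<circ> q) E" for p q E
    by (simp add: image_image o_def)
  have sub: "?act p E0 \<in> ?O" if "p \<in> ?P" for p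
  proof -
    have "?act p E0 \<subseteq> pairs V" using that image_pairs_permutes E0 by blast
    moreover have "graph_isom p (V, E0) (V, ?act p E0)"
      using that by (auto simp: graph_isom_def permutes_imp_bij)
    ultimately show ?thesis
      using abs_ugraph_eq_iff[of "(V, E0)" "(V, ?act p E0)"] E0 V by (auto simp: simple_graph_iff)
  qed
  have fiber: "card {p \<in> ?P. ?act p E0 = E} = card (automorphisms (V, E0))" if "E \<in> ?O" for E
  proof -
    have s: "simple_graph (V, E0)" "simple_graph (V, E)"
      using that E0 V by (auto simp: simple_graph_iff)
    have "abs_ugraph (V, E0) = abs_ugraph (V, E)" using that by simp
    then obtain f where f: "graph_isom f (V, E0) (V, E)"
      using abs_ugraph_eq_iff[OF s] by blast
    define p where "p x = (if x \<in> V then f x else x)" for x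
    have "bij_betw p V V"
      using f bij_betw_cong[of V p f V] by (simp add: graph_isom_def p_def)
    then have p: "p permutes V" by (intro bij_imp_permutes) (auto simp: p_def)
    have "p ` e = f ` e" if "e \<in> E0" for e
      using that E0 by (intro image_cong) (auto simp: p_def pairs_def)
    then have pE: "?act p E0 = E" using f by (auto simp: graph_isom_def)
    have inv: "inv_into UNIV p \<circ> p = id" "p \<circ> inv_into UNIV p = id"
      using permutes_inv_o[OF p] by auto
    have "bij_betw (\<lambda>q. p \<circ> q) (automorphisms (V, E0)) {p \<in> ?P. ?act p E0 = E}"
    proof (rule bij_betw_byWitness[where f' = "\<lambda>q. inv_into UNIV p \<circ> q"])
      show "\<forall>q\<in>automorphisms (V, E0). inv_into UNIV p \<circ> (p \<circ> q) = q"
        by (metis comp_assoc inv(1) id_comp)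
      show "\<forall>q\<in>{p \<in> ?P. ?act p E0 = E}. p \<circ> (inv_into UNIV p \<circ> q) = q"
        by (metis comp_assoc inv(2) id_comp)
      show "(\<circ>) p ` automorphisms (V, E0) \<subseteq> {p \<in> ?P. ?act p E0 = E}"
      proof (rule image_subsetI)
        fix q assume "q \<in> automorphisms (V, E0)"
        then have q: "q permutes V" "?act q E0 = E0" by (auto simp: automorphisms_def)
        then show "p \<circ> q \<in> {p \<in> ?P. ?act p E0 = E}"
          using comp[of p q E0] pE p by (auto intro: permutes_compose)
      qed
      show "(\<circ>) (inv_into UNIV p) ` {p \<in> ?P. ?act p E0 = E} \<subseteq> automorphisms (V, E0)"
      proof (rule image_subsetI)
        fix q assume "q \<in> {p \<in> ?P. ?act p E0 = E}"
        then have q: "q permutes V" "E = ?act q E0" by auto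
        have "?act (inv_into UNIV p \<circ> q) E0 = ?act (inv_into UNIV p) (?act p E0)"
          using comp[of "inv_into UNIV p" q E0] q pE by simp
        also have "\<dots> = ?act (inv_into UNIV p \<circ> p) E0" by (rule comp)
        also have "\<dots> = E0" by (simp add: inv(1))
        finally show "inv_into UNIV p \<circ> q \<in> automorphisms (V, E0)"
          using q p by (auto simp: automorphisms_def intro: permutes_compose permutes_inv)
      qed
    qed
    then show ?thesis by (rule bij_betw_same_card[symmetric])
  qed
  have "fact (card V) = card ?P" using V by (simp add: card_permutations)
  also have "\<dots> = (\<Sum>E\<in>?O. card {p \<in> ?P. ?act p E0 = E})"
    using sum.group[of ?P ?O "\<lambda>p. ?act p E0" "\<lambda>_. 1 :: nat"] sub V
    by (simp add: finite_permutations finite_pairs image_subset_iff)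
  also have "\<dots> = (\<Sum>E\<in>?O. card (automorphisms (V, E0)))"
    by (rule sum.cong[OF refl fiber])
  also have "\<dots> = card ?O * card (automorphisms (V, E0))"
    by simp
  finally show ?thesis by simp
qed

text \<open>
  An isomorphism class has \<open>(card V)! / aut_order U\<close> representatives with vertex set \<open>V\<close>.
\<close>
lemma sum_labelled_graphs:
  fixes f :: "ugraph \<Rightarrow> complex"
  assumes V: "finite V"
  shows "(\<Sum>E\<in>Pow (pairs V). f (abs_ugraph (V, E))) =
    fact (card V) * (\<Sum>U | num_verts U = card V. f U / of_nat (aut_order U))"
proof -
  let ?g = "\<lambda>E. abs_ugraph (V, E)"
  let ?T = "{U. num_verts U = card V}"
  have "(\<Sum>E\<in>Pow (pairs V). f (?g E)) = (\<Sum>U\<in>?T. \<Sum>E\<in>{E \<in> Pow (pairs V). ?g E = U}. f (?g E))"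
    using V by (intro sum.group[symmetric])
      (auto simp: finite_pairs finite_num_verts_class num_verts_class_eq_image)
  also have "\<dots> = (\<Sum>U\<in>?T. fact (card V) * (f U / of_nat (aut_order U)))"
  proof (rule sum.cong[OF refl])
    fix U assume "U \<in> ?T"
    then obtain E0 where E0: "E0 \<subseteq> pairs V" "U = ?g E0"
      using ugraph_on_vertices[OF V] by blast
    have eq: "of_nat (card {E \<in> Pow (pairs V). ?g E = U}) * of_nat (aut_order U) = (fact (card V) :: complex)"
      using card_labellings[OF V E0(1)] aut_order_abs[of "(V, E0)"] V E0
      by (simp add: simple_graph_iff flip: of_nat_mult)
    then have "of_nat (aut_order U) \<noteq> (0 :: complex)" by (intro notI) simp
    then have "of_nat (card {E \<in> Pow (pairs V). ?g E = U}) = (fact (card V) :: complex) / of_nat (aut_order U)"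
      using eq by (simp add: eq_divide_eq)
    then show "(\<Sum>E\<in>{E \<in> Pow (pairs V). ?g E = U}. f (?g E)) = fact (card V) * (f U / of_nat (aut_order U))"
      by simp
  qed
  finally show ?thesis by (simp add: sum_distrib_left)
qed

lemma sum_Pow_Un:
  assumes "A \<inter> B = {}"
  shows "(\<Sum>E\<in>Pow (A \<union> B). h (E \<inter> A) (E \<inter> B)) = (\<Sum>E1\<in>Pow A. \<Sum>E2\<in>Pow B. h E1 E2)"
  unfolding sum.cartesian_product
  by (rule sum.reindex_bij_witness[of _ "\<lambda>(E1, E2). E1 \<union> E2" "\<lambda>E. (E \<inter> A, E \<inter> B)"])
    (use assms in \<open>auto simp: Int_Un_distrib2 inf_commute\<close>)

lemma pairs_disjoint:
  assumes "W \<inter> W' = {}"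
  shows "pairs W \<inter> pairs W' = {}"
proof (rule equals0I)
  fix e assume e: "e \<in> pairs W \<inter> pairs W'"
  then have "e \<subseteq> W \<inter> W'" by (simp add: pairs_def)
  then have "e = {}" using assms by blast
  then show False using e by (simp add: pairs_def)
qed

text \<open>
  The graphs on \<open>V\<close> with prescribed induced subgraphs on \<open>W\<close> and \<open>V - W\<close> differ in the choice of
  the edges between \<open>W\<close> and \<open>V - W\<close>.
\<close>
lemma sum_induced_product:
  fixes f g :: "nat set set \<Rightarrow> complex"
  assumes V: "finite V" and W: "W \<subseteq> V"
  shows "(\<Sum>E\<in>Pow (pairs V). f (E \<inter> pairs W) * g (E \<inter> pairs (V - W))) =
    2 ^ (card V choose 2) / (2 ^ (card W choose 2) * 2 ^ (card (V - W) choose 2)) *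
    ((\<Sum>E\<in>Pow (pairs W). f E) * (\<Sum>E\<in>Pow (pairs (V - W)). g E))"
proof -
  let ?A = "pairs W \<union> pairs (V - W)"
  define C where "C = pairs V - ?A"
  have d: "pairs W \<inter> pairs (V - W) = {}" by (rule pairs_disjoint) auto
  have u: "pairs V = ?A \<union> C" using pairs_mono[OF W] pairs_mono[of "V - W" V] by (auto simp: C_def)
  have fin: "finite W" "finite (V - W)" "finite C"
    using V W by (auto simp: C_def finite_pairs intro: finite_subset)
  have disj: "?A \<inter> C = {}" by (auto simp: C_def)
  have "card V choose 2 = card (?A \<union> C)"
    using card_pairs[OF V] by (simp flip: u)
  also have "\<dots> = card ?A + card C"
    using fin disj by (intro card_Un_disjoint) (auto simp: finite_pairs)
  also have "card ?A = (card W choose 2) + (card (V - W) choose 2)"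
    using d fin by (simp add: card_Un_disjoint card_pairs finite_pairs)
  finally have c: "2 ^ (card V choose 2) / (2 ^ (card W choose 2) * 2 ^ (card (V - W) choose 2)) = (2 ^ card C :: complex)"
    by (simp add: power_add)
  have "(\<Sum>E\<in>Pow (pairs V). f (E \<inter> pairs W) * g (E \<inter> pairs (V - W))) =
      (\<Sum>E\<in>Pow (?A \<union> C). (\<lambda>E1 E2. f (E1 \<inter> pairs W) * g (E1 \<inter> pairs (V - W))) (E \<inter> ?A) (E \<inter> C))"
    unfolding u by (intro sum.cong refl) (simp add: Int_assoc Int_absorb1 Un_Int_distrib2)
  also have "\<dots> = (\<Sum>E1\<in>Pow ?A. \<Sum>E2\<in>Pow C. f (E1 \<inter> pairs W) * g (E1 \<inter> pairs (V - W)))"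
    by (rule sum_Pow_Un[OF disj])
  also have "\<dots> = 2 ^ card C * (\<Sum>E1\<in>Pow ?A. (\<lambda>E1 E2. f E1 * g E2) (E1 \<inter> pairs W) (E1 \<inter> pairs (V - W)))"
    using fin by (simp add: card_Pow sum_distrib_left)
  also have "(\<Sum>E1\<in>Pow ?A. (\<lambda>E1 E2. f E1 * g E2) (E1 \<inter> pairs W) (E1 \<inter> pairs (V - W))) =
      (\<Sum>E\<in>Pow (pairs W). f E) * (\<Sum>E\<in>Pow (pairs (V - W)). g E)"
    unfolding sum_product by (rule sum_Pow_Un[OF d])
  finally show ?thesis by (simp add: c)
qed

section \<open>Connected components\<close>

definition adjacency :: "nat set set \<Rightarrow> (nat \<times> nat) set" where
  "adjacency E = {(x, y). {x, y} \<in> E}"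

text \<open>The vertex set of the connected component of \<open>v\<close>.\<close>
definition component :: "nat set set \<Rightarrow> nat \<Rightarrow> nat set" where
  "component E v = {u. (v, u) \<in> (adjacency E)\<^sup>*}"

lemma connected_graph_iff:
  "connected_graph (V, E) \<longleftrightarrow> V \<noteq> {} \<and> (\<forall>u\<in>V. \<forall>v\<in>V. (u, v) \<in> (adjacency E)\<^sup>*)"
  by (simp add: connected_graph_def adjacency_def)

lemma sym_adjacency: "sym (adjacency E)"
  by (auto simp: adjacency_def sym_def insert_commute)

lemma adjacency_mono: "E \<subseteq> E' \<Longrightarrow> adjacency E \<subseteq> adjacency E'"
  by (auto simp: adjacency_def)

lemma adjacency_pairs: "E \<subseteq> pairs V \<Longrightarrow> (x, y) \<in> adjacency E \<Longrightarrow> x \<in> V \<and> y \<in> V"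
  by (auto simp: adjacency_def pairs_def)

lemma self_in_component: "v \<in> component E v"
  by (simp add: component_def)

lemma component_step: "u \<in> component E v \<Longrightarrow> (u, w) \<in> adjacency E \<Longrightarrow> w \<in> component E v"
  by (auto simp: component_def)

lemma component_subset_if_closed:
  assumes "v \<in> W" "\<And>x y. x \<in> W \<Longrightarrow> (x, y) \<in> adjacency E \<Longrightarrow> y \<in> W"
  shows "component E v \<subseteq> W"
proof -
  have "u \<in> W" if "(v, u) \<in> (adjacency E)\<^sup>*" for u
    using that assms by (induction rule: rtrancl_induct) auto
  then show ?thesis by (auto simp: component_def)
qed

lemma component_subset: "E \<subseteq> pairs V \<Longrightarrow> v \<in> V \<Longrightarrow> component E v \<subseteq> V"
  by (rule component_subset_if_closed) (auto dest: adjacency_pairs)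

lemma edges_split_component:
  assumes E: "E \<subseteq> pairs V"
  shows "E \<subseteq> pairs (component E v) \<union> pairs (V - component E v)"
proof
  fix e assume e: "e \<in> E"
  then obtain x y where xy: "e = {x, y}" using E by (auto simp: pairs_def card_2_iff)
  have "(x, y) \<in> adjacency E" "(y, x) \<in> adjacency E"
    using e xy by (auto simp: adjacency_def insert_commute)
  then have "x \<in> component E v \<longleftrightarrow> y \<in> component E v" using component_step by metis
  then show "e \<in> pairs (component E v) \<union> pairs (V - component E v)"
    using e E xy by (auto simp: pairs_def)
qed

lemma connected_component:
  assumes E: "E \<subseteq> pairs V"
  shows "connected_graph (component E v, E \<inter> pairs (component E v))"
proof -
  let ?R = "adjacency (E \<inter> pairs (component E v))"
  have v: "(v, u) \<in> ?R\<^sup>*" if "(v, u) \<in> (adjacency E)\<^sup>*" for u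
    using that
  proof (induction rule: rtrancl_induct)
    case (step y z)
    have "y \<in> component E v" using step.hyps(1) by (simp add: component_def)
    moreover from this have "z \<in> component E v" using step.hyps(2) component_step by metis
    ultimately have "(y, z) \<in> ?R"
      using step.hyps(2) E by (auto simp: adjacency_def pairs_def)
    then show ?case using step.IH by auto
  qed simp
  moreover have "sym (?R\<^sup>*)" by (rule sym_rtrancl[OF sym_adjacency])
  ultimately have "(u, w) \<in> ?R\<^sup>*" if "u \<in> component E v" "w \<in> component E v" for u w
    using that unfolding component_def by (blast dest: symD intro: rtrancl_trans)
  then show ?thesis using self_in_component[of v E] by (auto simp: connected_graph_iff)
qed

lemma component_union:
  assumes "E1 \<subseteq> pairs W" "E2 \<subseteq> pairs (V - W)" "connected_graph (W, E1)" "v \<in> W"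
  shows "component (E1 \<union> E2) v = W"
proof
  show "component (E1 \<union> E2) v \<subseteq> W"
  proof (rule component_subset_if_closed[OF assms(4)])
    fix x y assume "x \<in> W" "(x, y) \<in> adjacency (E1 \<union> E2)"
    then have "(x, y) \<in> adjacency E1 \<or> (x, y) \<in> adjacency E2" by (auto simp: adjacency_def)
    then show "y \<in> W"
      using adjacency_pairs[OF assms(1)] adjacency_pairs[OF assms(2)] \<open>x \<in> W\<close> by blast
  qed
  show "W \<subseteq> component (E1 \<union> E2) v"
    using assms(3,4) rtrancl_mono[OF adjacency_mono[of E1 "E1 \<union> E2"]]
    by (auto simp: connected_graph_iff component_def)
qed

lemma abs_ugraph_union:
  assumes V: "finite V" and W: "W \<subseteq> V" and E: "E1 \<subseteq> pairs W" "E2 \<subseteq> pairs (V - W)"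
  shows "abs_ugraph (V, E1 \<union> E2) = abs_ugraph (W, E1) + abs_ugraph (V - W, E2)"
proof -
  have s: "simple_graph (W, E1)" "simple_graph (V - W, E2)" "simple_graph (V, E1 \<union> E2)"
    using assms pairs_mono[OF W] pairs_mono[of "V - W" V]
    by (auto simp: simple_graph_iff intro: finite_subset)
  have "graph_isom (\<lambda>x. x div 2) (disjoint_union (W, E1) (V - W, E2)) (V, E1 \<union> E2)"
    using W by (auto simp: graph_isom_def disjoint_union_def bij_betw_def inj_on_def image_image
        image_Un)
  then have "abs_ugraph (disjoint_union (W, E1) (V - W, E2)) = abs_ugraph (V, E1 \<union> E2)"
    using abs_ugraph_eq_iff[OF simple_graph_disjoint_union[OF s(1,2)] s(3)] by blast
  then show ?thesis
    using plus_ugraph.abs_eq[OF graph_equiv_refl[OF s(1)] graph_equiv_refl[OF s(2)]] by simp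
qed

text \<open>
  A graph in which \<open>W\<close> is a component amounts to a connected graph on \<open>W\<close> and an arbitrary graph on
  \<open>V - W\<close>, of which it is the disjoint union.
\<close>
lemma sum_fixed_component:
  fixes f :: "ugraph \<Rightarrow> complex"
  assumes V: "finite V" and W: "W \<subseteq> V" and v: "v \<in> W"
  shows "(\<Sum>E | E \<in> Pow (pairs V) \<and> component E v = W. f (abs_ugraph (V, E))) =
    (\<Sum>E1 | E1 \<in> Pow (pairs W) \<and> connected_graph (W, E1). \<Sum>E2\<in>Pow (pairs (V - W)).
      f (abs_ugraph (W, E1) + abs_ugraph (V - W, E2)))"
  unfolding sum.cartesian_product
proof (rule sum.reindex_bij_witness[of _ "\<lambda>(E1, E2). E1 \<union> E2" "\<lambda>E. (E \<inter> pairs W, E \<inter> pairs (V - W))"])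
  fix E assume "E \<in> {E. E \<in> Pow (pairs V) \<and> component E v = W}"
  then have E: "E \<subseteq> pairs V" "component E v = W" by auto
  have split: "(E \<inter> pairs W) \<union> (E \<inter> pairs (V - W)) = E"
    using edges_split_component[OF E(1), of v] E(2) by auto
  then show "(case (E \<inter> pairs W, E \<inter> pairs (V - W)) of (E1, E2) \<Rightarrow> E1 \<union> E2) = E" by simp
  show "(E \<inter> pairs W, E \<inter> pairs (V - W)) \<in>
      {E1. E1 \<in> Pow (pairs W) \<and> connected_graph (W, E1)} \<times> Pow (pairs (V - W))"
    using connected_component[OF E(1), of v] E(2) by auto
  show "(case (E \<inter> pairs W, E \<inter> pairs (V - W)) of (E1, E2) \<Rightarrow>
      f (abs_ugraph (W, E1) + abs_ugraph (V - W, E2))) = f (abs_ugraph (V, E))"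
    using abs_ugraph_union[OF V W, of "E \<inter> pairs W" "E \<inter> pairs (V - W)"] split by simp
next
  fix p assume "p \<in> {E1. E1 \<in> Pow (pairs W) \<and> connected_graph (W, E1)} \<times> Pow (pairs (V - W))"
  then obtain E1 E2 where p: "p = (E1, E2)" "E1 \<subseteq> pairs W" "E2 \<subseteq> pairs (V - W)" "connected_graph (W, E1)"
    by auto
  have "pairs W \<inter> pairs (V - W) = {}" by (rule pairs_disjoint) auto
  then show "((case p of (E1, E2) \<Rightarrow> E1 \<union> E2) \<inter> pairs W, (case p of (E1, E2) \<Rightarrow> E1 \<union> E2) \<inter> pairs (V - W)) = p"
    using p by auto
  show "(case p of (E1, E2) \<Rightarrow> E1 \<union> E2) \<in> {E. E \<in> Pow (pairs V) \<and> component E v = W}"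
    using component_union[OF p(2,3,4) v] p pairs_mono[OF W] pairs_mono[of "V - W" V] by auto
qed

text \<open>
  Both sides are sums over the labelled graphs with a distinguished vertex; on the right, \<open>W\<close> is
  the component of that vertex.
\<close>
lemma sum_labelled_graphs_component:
  fixes f :: "ugraph \<Rightarrow> complex"
  assumes V: "finite V"
  shows "of_nat (card V) * (\<Sum>E\<in>Pow (pairs V). f (abs_ugraph (V, E))) =
    (\<Sum>W\<in>Pow V. of_nat (card W) *
      (\<Sum>E1 | E1 \<in> Pow (pairs W) \<and> connected_graph (W, E1). \<Sum>E2\<in>Pow (pairs (V - W)).
        f (abs_ugraph (W, E1) + abs_ugraph (V - W, E2))))"
    (is "_ = (\<Sum>W\<in>Pow V. of_nat (card W) * ?X W)")
proof -
  have "(\<Sum>E\<in>Pow (pairs V). f (abs_ugraph (V, E))) = (\<Sum>W | W \<in> Pow V \<and> v \<in> W. ?X W)" if v: "v \<in> V" for v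
  proof -
    have "(\<Sum>E\<in>Pow (pairs V). f (abs_ugraph (V, E))) =
        (\<Sum>W | W \<in> Pow V \<and> v \<in> W. \<Sum>E | E \<in> Pow (pairs V) \<and> component E v = W. f (abs_ugraph (V, E)))"
      using V v component_subset self_in_component
      by (intro sum.group[symmetric]) (auto simp: finite_pairs)
    also have "\<dots> = (\<Sum>W | W \<in> Pow V \<and> v \<in> W. ?X W)"
      using V by (intro sum.cong refl sum_fixed_component) auto
    finally show ?thesis .
  qed
  then have "of_nat (card V) * (\<Sum>E\<in>Pow (pairs V). f (abs_ugraph (V, E))) =
      (\<Sum>v\<in>V. \<Sum>W | W \<in> Pow V \<and> v \<in> W. ?X W)"
    by (metis (no_types, lifting) sum.cong sum_constant)
  also have "\<dots> = (\<Sum>W\<in>Pow V. \<Sum>v | v \<in> V \<and> v \<in> W. ?X W)"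
    using V by (intro sum.swap_restrict) auto
  also have "\<dots> = (\<Sum>W\<in>Pow V. of_nat (card W) * ?X W)"
  proof (rule sum.cong[OF refl])
    fix W assume "W \<in> Pow V"
    then have "{v. v \<in> V \<and> v \<in> W} = W" by auto
    then show "(\<Sum>v | v \<in> V \<and> v \<in> W. ?X W) = of_nat (card W) * ?X W" by simp
  qed
  finally show ?thesis .
qed

section \<open>The generating functions\<close>

context
  fixes I :: "graph_algebra \<Rightarrow> qpoly"
  assumes I: "umbral_invariant I"
begin

lemma mcoeff_gf_all:
  "mcoeff (gf_all I) m =
    (\<Sum>U | num_verts U = wdeg m. lookup (graph_value I U) m / of_nat (aut_order U))"
  unfolding gf_all_def mcoeff_mps_sum
  by (subst sum'_eq_sum[OF finite_num_verts_class[of "wdeg m"]])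
    (auto simp: mcoeff_mscale mps_of_poly_def Mps_inverse lookup_graph_value_eq_0[OF I])

lemma mcoeff_gf_connected:
  "mcoeff (gf_connected I) m = (\<Sum>U | num_verts U = wdeg m.
     (if connected_ugraph U then lookup (graph_value I U) m else 0) / of_nat (aut_order U))"
proof -
  have "mcoeff (gf_connected I) m =
      (\<Sum>U | num_verts U = wdeg m \<and> connected_ugraph U. lookup (graph_value I U) m / of_nat (aut_order U))"
    unfolding gf_connected_def mcoeff_mps_sum
    by (subst sum'_eq_sum[of "{U. num_verts U = wdeg m \<and> connected_ugraph U}"])
      (auto simp: finite_num_verts_class mcoeff_mscale mps_of_poly_def Mps_inverse
        lookup_graph_value_eq_0[OF I])
  also have "\<dots> = (\<Sum>U | num_verts U = wdeg m.
      (if connected_ugraph U then lookup (graph_value I U) m else 0) / of_nat (aut_order U))"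
    by (rule sum.mono_neutral_cong_left) (auto simp: finite_num_verts_class)
  finally show ?thesis .
qed

lemma rescaling_const_eq: "rescaling_const I (Suc j) = fact (Suc j) * mcoeff (gf_connected I) (var_mon (Suc j))"
  by (simp add: rescaling_const_def gf_connected_def mcoeff_mps_sum mcoeff_mscale mps_of_poly_def Mps_inverse)

text \<open>As the invariant is graded, only the graphs with \<open>wdeg m\<close> vertices contribute to \<open>m\<close>.\<close>
lemma sum_labelled_graph_value:
  assumes V: "finite V"
  shows "(\<Sum>E\<in>Pow (pairs V). lookup (graph_value I (abs_ugraph (V, E))) m) =
    (if card V = wdeg m then fact (wdeg m) * mcoeff (gf_all I) m else 0)"
proof (cases "card V = wdeg m")
  case True
  then show ?thesis
    using sum_labelled_graphs[OF V, of "\<lambda>U. lookup (graph_value I U) m"] by (simp add: mcoeff_gf_all)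
next
  case False
  then show ?thesis
    using V by (auto simp: lookup_graph_value_eq_0[OF I] num_verts_abs simple_graph_iff intro!: sum.neutral)
qed

lemma sum_labelled_connected_graph_value:
  assumes V: "finite V"
  shows "(\<Sum>E | E \<in> Pow (pairs V) \<and> connected_graph (V, E).
      lookup (graph_value I (abs_ugraph (V, E))) m) =
    (if card V = wdeg m then fact (wdeg m) * mcoeff (gf_connected I) m else 0)"
proof -
  let ?f = "\<lambda>U. if connected_ugraph U then lookup (graph_value I U) m else 0"
  have "(\<Sum>E | E \<in> Pow (pairs V) \<and> connected_graph (V, E). lookup (graph_value I (abs_ugraph (V, E))) m) =
      (\<Sum>E\<in>Pow (pairs V). if connected_graph (V, E) then lookup (graph_value I (abs_ugraph (V, E))) m else 0)"
    using V by (intro sum.inter_filter) (simp add: finite_pairs)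
  also have "\<dots> = (\<Sum>E\<in>Pow (pairs V). ?f (abs_ugraph (V, E)))"
    using V by (intro sum.cong) (auto simp: connected_ugraph_abs simple_graph_iff)
  also have "\<dots> = (if card V = wdeg m then fact (wdeg m) * mcoeff (gf_connected I) m else 0)"
  proof (cases "card V = wdeg m")
    case True
    then show ?thesis using sum_labelled_graphs[OF V, of ?f] by (simp add: mcoeff_gf_connected)
  next
    case False
    then show ?thesis
      using V by (auto simp: lookup_graph_value_eq_0[OF I] num_verts_abs simple_graph_iff intro!: sum.neutral)
  qed
  finally show ?thesis .
qed

lemma mcoeff_gf_all_0: "mcoeff (gf_all I) 0 = 1"
proof -
  have "pairs {} = {}" by (auto simp: pairs_def)
  moreover have "abs_ugraph ({}, {}) = 0" by (simp add: zero_ugraph_def)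
  ultimately show ?thesis
    using sum_labelled_graph_value[of "{}" 0] by (simp add: graph_value_0[OF I])
qed

lemma mcoeff_gf_connected_0: "mcoeff (gf_connected I) 0 = 0"
  using sum_labelled_connected_graph_value[of "{}" 0] by (simp add: connected_graph_def)

text \<open>
  A function on the subsets of a set with \<open>k + l\<close> elements that is supported on the subsets with
  \<open>k\<close> elements and constant there; the denominator is their number \<open>(k + l) choose k\<close>.
\<close>
lemma sum_Pow_card:
  fixes c :: complex
  assumes "finite V" "card V = k + l"
    and "\<And>W. W \<subseteq> V \<Longrightarrow> h W = (if card W = k then c / (fact (k + l) / (fact k * fact l)) else 0)"
  shows "(\<Sum>W\<in>Pow V. h W) = c"
proof -
  have "(\<Sum>W\<in>Pow V. h W) = (\<Sum>W | W \<subseteq> V \<and> card W = k. c / (fact (k + l) / (fact k * fact l)))"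
    using assms by (intro sum.mono_neutral_cong_right) auto
  also have "\<dots> = of_nat ((k + l) choose k) * (c / (fact (k + l) / (fact k * fact l)))"
    using n_subsets[OF assms(1), of k] assms(2) by simp
  also have "\<dots> = c"
    by (simp add: binomial_fact)
  finally show ?thesis .
qed

text \<open>
  A series with constant term 1 is group-like if its coefficients, multiplied by \<open>mon_fact\<close>, are multiplicative. The
  powers of 2 compensate for the free choice of the edges between the two parts of the vertex set
  in the coproduct of a sum over all labelled graphs.
\<close>
lemma gf_all_group_like:
  "mon_fact (a + b) * mcoeff (gf_all I) (a + b) / 2 ^ (wdeg (a + b) choose 2) =
    (mon_fact a * mcoeff (gf_all I) a / 2 ^ (wdeg a choose 2)) *
    (mon_fact b * mcoeff (gf_all I) b / 2 ^ (wdeg b choose 2))"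
proof -
  let ?k = "wdeg a" and ?l = "wdeg b"
  let ?A = "mcoeff (gf_all I)"
  define V where "V = {..<?k + ?l}"
  have V: "finite V" "card V = ?k + ?l" by (auto simp: V_def)
  let ?v = "\<lambda>W E m. lookup (graph_value I (abs_ugraph (W, E))) m"
  let ?r = "fact (?k + ?l) / (fact ?k * fact ?l) :: complex"
  define c where "c = 2 ^ (?k + ?l choose 2) / (2 ^ (?k choose 2) * 2 ^ (?l choose 2)) *
    (fact (?k + ?l) * ?A a * ?A b)"
  have "fact (?k + ?l) * ?A (a + b) * (mon_fact (a + b) / (mon_fact a * mon_fact b)) =
      (\<Sum>E\<in>Pow (pairs V). ?v V E (a + b) * mon_fact (a + b) / (mon_fact a * mon_fact b))"
    using sum_labelled_graph_value[OF V(1), of "a + b"] V(2)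
    by (simp add: wdeg_add flip: sum_distrib_right sum_divide_distrib)
  also have "\<dots> = (\<Sum>E\<in>Pow (pairs V). \<Sum>W\<in>Pow V. ?v W (E \<inter> pairs W) a * ?v (V - W) (E \<inter> pairs (V - W)) b)"
  proof (rule sum.cong[OF refl])
    fix E assume "E \<in> Pow (pairs V)"
    then show "?v V E (a + b) * mon_fact (a + b) / (mon_fact a * mon_fact b) =
        (\<Sum>W\<in>Pow V. ?v W (E \<inter> pairs W) a * ?v (V - W) (E \<inter> pairs (V - W)) b)"
      using graph_value_coprod[OF I, of "(V, E)" a b] V
      by (simp add: simple_graph_iff induced_eq)
  qed
  also have "\<dots> = (\<Sum>W\<in>Pow V. \<Sum>E\<in>Pow (pairs V). ?v W (E \<inter> pairs W) a * ?v (V - W) (E \<inter> pairs (V - W)) b)"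
    by (rule sum.swap)
  also have "\<dots> = c"
  proof (rule sum_Pow_card[OF V])
    fix W assume W: "W \<subseteq> V"
    have fW: "finite W" using W V finite_subset by blast
    have card: "card (V - W) = ?k + ?l - card W" using W V by (simp add: card_Diff_subset fW)
    show "(\<Sum>E\<in>Pow (pairs V). ?v W (E \<inter> pairs W) a * ?v (V - W) (E \<inter> pairs (V - W)) b) =
        (if card W = ?k then c / ?r else 0)"
      using sum_induced_product[OF V(1) W, of "\<lambda>E. ?v W E a" "\<lambda>E. ?v (V - W) E b"]
      unfolding sum_labelled_graph_value[OF fW]
        sum_labelled_graph_value[OF finite_Diff[OF V(1), of W]] card V(2)
      by (auto simp: c_def field_simps)
  qed
  finally show ?thesis
    by (simp add: c_def wdeg_add mon_fact_nonzero field_simps)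
qed

text \<open>
  The exponential formula as a differential equation. The derivation counts the choices of a vertex:
  on the left in the whole graph, on the right in the connected graph that is its component.
\<close>
lemma euler_deriv_gf_all: "euler_deriv (gf_all I) = euler_deriv (gf_connected I) * gf_all I"
proof (rule mps_eqI)
  fix m
  let ?n = "wdeg m"
  let ?A = "mcoeff (gf_all I)" and ?C = "mcoeff (gf_connected I)"
  let ?v = "\<lambda>W E m. lookup (graph_value I (abs_ugraph (W, E))) m"
  define V where "V = {..<?n}"
  have V: "finite V" "card V = ?n" by (auto simp: V_def)
  have "of_nat ?n * (fact ?n * ?A m) = of_nat (card V) * (\<Sum>E\<in>Pow (pairs V). ?v V E m)"
    using sum_labelled_graph_value[OF V(1), of m] V(2) by simp
  also have "\<dots> = (\<Sum>W\<in>Pow V. of_nat (card W) *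
      (\<Sum>E1 | E1 \<in> Pow (pairs W) \<and> connected_graph (W, E1). \<Sum>E2\<in>Pow (pairs (V - W)).
        \<Sum>(a, b)\<in>splits m. ?v W E1 a * ?v (V - W) E2 b))"
    using sum_labelled_graphs_component[OF V(1), of "\<lambda>U. lookup (graph_value I U) m"]
    by (simp add: graph_value_add[OF I] lookup_times_splits)
  also have "\<dots> = (\<Sum>W\<in>Pow V. of_nat (card W) * (\<Sum>(a, b)\<in>splits m.
      (\<Sum>E1 | E1 \<in> Pow (pairs W) \<and> connected_graph (W, E1). ?v W E1 a) *
      (\<Sum>E2\<in>Pow (pairs (V - W)). ?v (V - W) E2 b)))"
  proof (intro sum.cong refl arg_cong[where f = "(*) _"])
    fix W
    let ?S = "{E1. E1 \<in> Pow (pairs W) \<and> connected_graph (W, E1)}"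
    let ?T = "Pow (pairs (V - W))"
    have "(\<Sum>E1\<in>?S. \<Sum>E2\<in>?T. \<Sum>p\<in>splits m. ?v W E1 (fst p) * ?v (V - W) E2 (snd p)) =
        (\<Sum>p\<in>splits m. \<Sum>E1\<in>?S. \<Sum>E2\<in>?T. ?v W E1 (fst p) * ?v (V - W) E2 (snd p))"
      by (subst sum.swap[of _ "splits m" ?T], subst sum.swap[of _ "splits m" ?S]) (rule refl)
    then show "(\<Sum>E1\<in>?S. \<Sum>E2\<in>?T. \<Sum>(a, b)\<in>splits m. ?v W E1 a * ?v (V - W) E2 b) =
        (\<Sum>(a, b)\<in>splits m. (\<Sum>E1\<in>?S. ?v W E1 a) * (\<Sum>E2\<in>?T. ?v (V - W) E2 b))"
      by (simp add: case_prod_unfold sum_product)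
  qed
  also have "\<dots> = (\<Sum>(a, b)\<in>splits m. \<Sum>W\<in>Pow V. of_nat (card W) *
      ((\<Sum>E1 | E1 \<in> Pow (pairs W) \<and> connected_graph (W, E1). ?v W E1 a) *
      (\<Sum>E2\<in>Pow (pairs (V - W)). ?v (V - W) E2 b)))"
    unfolding sum_distrib_left case_prod_unfold by (rule sum.swap)
  also have "\<dots> = (\<Sum>(a, b)\<in>splits m. fact ?n * (of_nat (wdeg a) * ?C a * ?A b))"
  proof (intro sum.cong refl, clarify)
    fix a b assume m: "m = a + b"
    let ?k = "wdeg a" and ?l = "wdeg b"
    have n: "card V = ?k + ?l" using V m by (simp add: wdeg_add)
    show "(\<Sum>W\<in>Pow V. of_nat (card W) *
        ((\<Sum>E1 | E1 \<in> Pow (pairs W) \<and> connected_graph (W, E1). ?v W E1 a) *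
        (\<Sum>E2\<in>Pow (pairs (V - W)). ?v (V - W) E2 b))) = fact (wdeg (a + b)) * (of_nat ?k * ?C a * ?A b)"
    proof (rule sum_Pow_card[OF V(1) n])
      fix W assume W: "W \<subseteq> V"
      have fW: "finite W" using W V finite_subset by blast
      have card: "card (V - W) = ?k + ?l - card W" using W n by (simp add: card_Diff_subset fW)
      show "of_nat (card W) *
          ((\<Sum>E1 | E1 \<in> Pow (pairs W) \<and> connected_graph (W, E1). ?v W E1 a) *
          (\<Sum>E2\<in>Pow (pairs (V - W)). ?v (V - W) E2 b)) =
          (if card W = ?k then fact (wdeg (a + b)) * (of_nat ?k * ?C a * ?A b) /
             (fact (?k + ?l) / (fact ?k * fact ?l)) else 0)"
        unfolding sum_labelled_connected_graph_value[OF fW]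
          sum_labelled_graph_value[OF finite_Diff[OF V(1), of W]] card
        by (auto simp: wdeg_add field_simps)
    qed
  qed
  also have "\<dots> = fact ?n * mcoeff (euler_deriv (gf_connected I) * gf_all I) m"
    by (simp add: mcoeff_times mcoeff_euler_deriv sum_distrib_left case_prod_unfold)
  finally show "mcoeff (euler_deriv (gf_all I)) m = mcoeff (euler_deriv (gf_connected I) * gf_all I) m"
    by (simp add: mcoeff_euler_deriv algebra_simps)
qed

text \<open>The logarithm does not change the linear part.\<close>
lemma mcoeff_gf_connected_var: "mcoeff (gf_connected I) (var_mon (Suc j)) = mcoeff (gf_all I) (var_mon (Suc j))"
proof -
  let ?m = "var_mon (Suc j)"
  have eq: "(a, b) = (?m, 0) \<or> a = 0" if "a + b = ?m" for a b
  proof (cases "a = 0")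
    case False
    then obtain i where i: "lookup a i \<noteq> 0" by (auto simp: poly_mapping_eq_iff fun_eq_iff)
    have l: "lookup a x + lookup b x = (if x = j then 1 else 0)" for x
      using that by (metis lookup_add lookup_var_mon)
    have "i = j" using l[of i] i by (auto split: if_splits)
    then have "lookup b x = 0" for x using l[of x] i by (cases "x = j") auto
    then have "b = 0" by (simp add: poly_mapping_eq_iff fun_eq_iff)
    then show ?thesis using that by simp
  qed simp
  have "mcoeff (euler_deriv (gf_connected I) * gf_all I) ?m =
      (\<Sum>(a, b)\<in>{(?m, 0)}. mcoeff (euler_deriv (gf_connected I)) a * mcoeff (gf_all I) b)"
    unfolding mcoeff_times
  proof (rule sum.mono_neutral_right[OF finite_mon_splits])
    show "\<forall>p\<in>splits ?m - {(?m, 0)}.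
        (case p of (a, b) \<Rightarrow> mcoeff (euler_deriv (gf_connected I)) a * mcoeff (gf_all I) b) = 0"
    proof
      fix p assume "p \<in> splits ?m - {(?m, 0)}"
      then have "fst p = 0" using eq[of "fst p" "snd p"] by (cases p) auto
      then show "(case p of (a, b) \<Rightarrow> mcoeff (euler_deriv (gf_connected I)) a * mcoeff (gf_all I) b) = 0"
        by (simp add: case_prod_unfold mcoeff_euler_deriv)
    qed
  qed auto
  then have "mcoeff (euler_deriv (gf_all I)) ?m = mcoeff (euler_deriv (gf_connected I)) ?m"
    by (simp add: euler_deriv_gf_all mcoeff_gf_all_0)
  then show ?thesis by (simp add: mcoeff_euler_deriv wdeg_var_mon del: of_nat_Suc)
qed

end

section \<open>Combinations of one-part Schur functions\<close>

text \<open>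
  The factors of the wedge product \<open>(\<Sum>\<^sub>n c\<^sub>n z\<^bsup>n-1\<^esup>) \<and> z\<^bsup>-2\<^esup> \<and> z\<^bsup>-3\<^esup> \<and> \<dots>\<close>; the value at
  \<open>i = 0\<close> is irrelevant.
\<close>
definition one_part_frame :: "(nat \<Rightarrow> complex) \<Rightarrow> nat \<Rightarrow> complex fls" where
  "one_part_frame c i = fls_shift (int i) (fps_to_fls (if i = 1 then Abs_fps c else 1))"

lemma one_part_frame_nth_1: "fls_nth (one_part_frame c 1) k = (if k < - 1 then 0 else c (nat (k + 1)))"
  by (simp add: one_part_frame_def)

lemma one_part_frame_nth: "i \<noteq> 1 \<Longrightarrow> fls_nth (one_part_frame c i) k = (if k = - int i then 1 else 0)"
  by (auto simp: one_part_frame_def)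

lemma kp_frame_one_part:
  assumes "c 0 = 1"
  shows "kp_frame (one_part_frame c)"
  unfolding kp_frame_def
proof (intro allI impI conjI)
  fix i :: nat
  show nth: "fls_nth (one_part_frame c i) (- int i) = 1"
    using assms by (cases "i = 1") (simp_all add: one_part_frame_nth_1[simplified] one_part_frame_nth)
  have "fls_nth (one_part_frame c i) k = 0" if "k < - int i" for k
    using that by (cases "i = 1") (simp_all add: one_part_frame_nth_1[simplified] one_part_frame_nth)
  then show "fls_subdegree (one_part_frame c i) = - int i"
    using nth by (intro fls_subdegree_eqI) auto
qed

lemma wedge_exponent_ge:
  assumes "i \<ge> 1" "i \<le> length \<mu>" "is_partition \<mu>"
  shows "wedge_exponent \<mu> i \<ge> 1 - int i"
proof -
  have "\<mu> ! (i - 1) \<in> set \<mu>" using assms by (intro nth_mem) auto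
  then have "\<mu> ! (i - 1) \<noteq> 0" using assms(3) unfolding is_partition_def by metis
  then show ?thesis using assms by (simp add: wedge_exponent_def)
qed

text \<open>
  All factors but the first are the monomials \<open>z\<^bsup>-i\<^esup>\<close> of the vacuum, so that only the partitions with
  at most one part occur, each with the identity permutation only.
\<close>
lemma wedge_coeff_one_part:
  assumes \<mu>: "is_partition \<mu>"
  shows "wedge_coeff (one_part_frame c) \<mu> = (if length \<mu> \<le> 1 then c (sum_list \<mu>) else 0)"
proof -
  let ?P = "{\<sigma>::nat \<Rightarrow> nat. permutation \<sigma> \<and> \<sigma> permutes {1..}}"
  let ?e = "\<lambda>\<sigma> i. fls_nth (one_part_frame c i) (wedge_exponent \<mu> (\<sigma> i))"
  define t where "t \<sigma> = of_int (sign \<sigma>) * prod' (?e \<sigma>) {1..}" for \<sigma>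
  \<comment> \<open>a permutation contributes only if it selects the one term of every factor but the first\<close>
  have exponent: "wedge_exponent \<mu> (\<sigma> i) = - int i"
    if \<sigma>: "\<sigma> \<in> ?P" and t: "t \<sigma> \<noteq> 0" and i: "i \<ge> 2" for \<sigma> i
  proof (rule ccontr)
    assume "wedge_exponent \<mu> (\<sigma> i) \<noteq> - int i"
    then have 0: "?e \<sigma> i = 0" using i by (simp add: one_part_frame_nth)
    let ?S = "{i \<in> {1..}. ?e \<sigma> i \<noteq> 1}"
    have "?S \<subseteq> {i. \<sigma> i \<noteq> i} \<union> {..length \<mu>} \<union> {1}"
      by (auto simp: one_part_frame_nth wedge_exponent_def)
    then have "finite ?S"
      using \<sigma> by (auto simp: permutation intro: finite_subset)
    moreover have "i \<in> ?S" using 0 i by simp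
    ultimately have "prod' (?e \<sigma>) {1..} = 0"
      using 0 unfolding prod.G_def by (auto intro!: prod_zero)
    then show False using t by (simp add: t_def)
  qed
  have t_sum: "wedge_coeff (one_part_frame c) \<mu> = sum' t ?P"
    by (simp add: wedge_coeff_def t_def[abs_def])
  show ?thesis
  proof (cases "length \<mu> \<le> 1")
    case False
    have "t \<sigma> = 0" if \<sigma>: "\<sigma> \<in> ?P" for \<sigma>
    proof (rule ccontr)
      assume t: "t \<sigma> \<noteq> 0"
      have p: "\<sigma> permutes {1..}" using \<sigma> by simp
      \<comment> \<open>one of the two largest exponents is not taken from the first factor, but exceeds \<open>-2\<close>\<close>
      obtain i j where ij: "i \<ge> 2" "\<sigma> i = j" "j = 1 \<or> j = 2"
      proof -
        define x y where "x = inv_into UNIV \<sigma> 1" and "y = inv_into UNIV \<sigma> 2"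
        have xy: "\<sigma> x = 1" "\<sigma> y = 2"
          using permutes_surj[OF p] by (auto simp: x_def y_def surj_f_inv_f)
        moreover have "x \<ge> 1" "y \<ge> 1"
          using xy permutes_in_image[OF p, of x] permutes_in_image[OF p, of y] by auto
        moreover have "x \<noteq> y" using xy by auto
        ultimately show ?thesis using that[of x 1] that[of y 2] by (cases "x = 1") auto
      qed
      have "wedge_exponent \<mu> j \<ge> 1 - int j"
        using ij False by (intro wedge_exponent_ge[OF _ _ \<mu>]) auto
      then show False using exponent[OF \<sigma> t ij(1)] ij by auto
    qed
    then have "sum' t ?P = sum t {}" by (intro sum'_eq_sum) auto
    then show ?thesis using False t_sum by simp
  next
    case True
    have low: "wedge_exponent \<mu> i = - int i" if "i \<ge> 2" for i
      using that True by (simp add: wedge_exponent_def)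
    have first: "wedge_exponent \<mu> 1 = int (sum_list \<mu>) - 1"
      using True by (cases \<mu>) (auto simp: wedge_exponent_def)
    have "\<sigma> = id" if \<sigma>: "\<sigma> \<in> ?P" and t: "t \<sigma> \<noteq> 0" for \<sigma>
    proof -
      have p: "\<sigma> permutes {1..}" using \<sigma> by simp
      have fix2: "\<sigma> i = i" if i: "i \<ge> 2" for i
      proof -
        have e: "wedge_exponent \<mu> (\<sigma> i) = - int i" by (rule exponent[OF \<sigma> t i])
        have "\<sigma> i \<ge> 1" using permutes_in_image[OF p, of i] i by simp
        moreover have "\<sigma> i \<noteq> 1" using e first i by auto
        ultimately show ?thesis using low[of "\<sigma> i"] e by simp
      qed
      have fix0: "\<sigma> 0 = 0" using p by (simp add: permutes_def)
      have "\<sigma> 1 = 1"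
        using fix2[of "\<sigma> 1"] fix0 permutes_inj[OF p] permutes_in_image[OF p, of 1]
        by (metis One_nat_def Suc_1 atLeast_iff injD le_refl not_less_eq_eq verit_la_disequality)
      then have "\<sigma> i = i" for i
        using fix0 fix2[of i] by (cases "i = 0"; cases "i = 1") auto
      then show ?thesis by auto
    qed
    moreover have "id \<in> ?P" by (simp add: permutes_id)
    ultimately have "sum' t ?P = sum t {id}" by (intro sum'_eq_sum) auto
    moreover have "prod' (?e id) {1..} = prod' (?e id) {1}"
      by (rule prod.mono_neutral_right') (use low in \<open>auto simp: one_part_frame_nth\<close>)
    ultimately show ?thesis
      using True t_sum first by (simp add: t_def sign_id one_part_frame_nth_1[simplified])
  qed
qed

text \<open>The series \<open>\<Sum>\<^sub>n p\<^sub>n / n\<close>, whose exponential is the sum of the one-part Schur functions.\<close>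
definition power_sum_series :: mps where
  "power_sum_series = mps_sum (\<lambda>k. mscale (1 / of_nat k) (mvar k)) {1..}"

lemma mcoeff_power_sum_series:
  "mcoeff power_sum_series m = (if \<exists>j. m = var_mon (Suc j) then 1 / of_nat (wdeg m) else 0)"
proof (cases "\<exists>j. m = var_mon (Suc j)")
  case True
  then obtain j where j: "m = var_mon (Suc j)" by blast
  have "m = var_mon k \<longleftrightarrow> k = Suc j" if "k \<ge> 1" for k
    using that j by (cases k) (auto simp: var_mon_inject)
  then have "mcoeff power_sum_series m = (\<Sum>k\<in>{Suc j}. 1 / of_nat k)"
    unfolding power_sum_series_def mcoeff_mps_sum
    by (subst sum'_eq_sum[of "{Suc j}"]) (auto simp: mcoeff_mscale mvar.rep_eq)
  then show ?thesis using j by (auto simp: wdeg_var_mon)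
next
  case False
  then have "m \<noteq> var_mon k" if "k \<ge> 1" for k using that by (metis Suc_pred' less_eq_Suc_le One_nat_def)
  then have "mcoeff power_sum_series m = (\<Sum>k\<in>{}. 1 / of_nat k)"
    unfolding power_sum_series_def mcoeff_mps_sum
    by (subst sum'_eq_sum[of "{}"]) (auto simp: mcoeff_mscale mvar.rep_eq)
  then show ?thesis using False by simp
qed

lemma mcoeff_power_sum_series_0: "mcoeff power_sum_series 0 = 0"
  using var_mon_neq_0 by (metis mcoeff_power_sum_series)

lemma mcoeff_schur1: "mcoeff (schur1 (int n)) m = (if wdeg m = n then mcoeff (mps_exp power_sum_series) m else 0)"
  by (simp add: schur1_def hom_part.rep_eq power_sum_series_def)

lemma schur_Nil: "schur [] = schur1 0"
proof (rule mps_eqI)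
  fix m
  show "mcoeff (schur []) m = mcoeff (schur1 0) m"
    using mcoeff_schur1[of 0 m]
    by (auto simp: schur_def mcoeff_one wdeg_eq_0_iff mcoeff_mps_exp_0[OF mcoeff_power_sum_series_0])
qed

lemma schur_single: "schur [n] = schur1 (int n)"
  by (simp add: schur_def det_single)

text \<open>The assumption on \<open>T\<close> says that \<open>T\<close> is the sum of the series \<open>c n\<close> times \<open>s\<^sub>n\<close>.\<close>
lemma kp_tau_one_part:
  assumes c0: "c 0 = 1" and T: "\<And>m. mcoeff T m = c (wdeg m) * mcoeff (mps_exp power_sum_series) m"
  shows "kp_tau T"
  unfolding kp_tau_def
proof (intro exI[of _ "one_part_frame c"] conjI mps_eqI)
  show "kp_frame (one_part_frame c)" using c0 by (rule kp_frame_one_part)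
  fix m
  let ?f = "\<lambda>\<mu>. mcoeff (mscale (wedge_coeff (one_part_frame c) \<mu>) (schur \<mu>)) m"
  define \<mu>0 where "\<mu>0 = (if wdeg m = 0 then [] else [wdeg m])"
  have part: "is_partition \<mu>0" by (simp add: \<mu>0_def is_partition_def)
  have "?f \<mu> = 0" if \<mu>: "is_partition \<mu>" and ne: "\<mu> \<noteq> \<mu>0" for \<mu>
  proof (cases "length \<mu> \<le> 1")
    case False
    then show ?thesis by (simp add: mcoeff_mscale wedge_coeff_one_part[OF \<mu>])
  next
    case True
    then consider "\<mu> = []" | n where "\<mu> = [n]" "n \<noteq> 0"
      using \<mu> by (cases \<mu>) (auto simp: is_partition_def)
    then have "mcoeff (schur \<mu>) m = 0"
    proof cases
      case 1
      then show ?thesis using ne mcoeff_schur1[of 0 m] by (auto simp: \<mu>0_def schur_Nil split: if_splits)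
    next
      case 2
      then show ?thesis using ne by (auto simp: \<mu>0_def schur_single mcoeff_schur1 split: if_splits)
    qed
    then show ?thesis by (simp add: mcoeff_mscale)
  qed
  then have "mcoeff (mps_sum (\<lambda>\<mu>. mscale (wedge_coeff (one_part_frame c) \<mu>) (schur \<mu>)) {\<mu>. is_partition \<mu>}) m = ?f \<mu>0"
    unfolding mcoeff_mps_sum using part by (subst sum'_eq_sum[of "{\<mu>0}"]) auto
  also have "\<dots> = mcoeff T m"
    using mcoeff_schur1[of 0 m] wedge_coeff_one_part[OF part, of c]
    by (auto simp: \<mu>0_def T mcoeff_mscale schur_Nil schur_single mcoeff_schur1)
  finally show "mcoeff T m = mcoeff (mps_sum (\<lambda>\<mu>. mscale (wedge_coeff (one_part_frame c) \<mu>) (schur \<mu>)) {\<mu>. is_partition \<mu>}) m" ..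
qed

text \<open>
  A group-like series, with coefficients \<open>g m / mon_fact m\<close>, is determined by its linear part, which
  is \<open>\<Sum>\<^sub>n p\<^sub>n / n\<close> here.
\<close>
lemma mcoeff_mps_exp_power_sum_series:
  assumes g0: "g 0 = 1" and g_add: "\<And>a b. g (a + b) = g a * g b"
    and g_var: "\<And>j. g (var_mon (Suc j)) = 1 / of_nat (Suc j)"
  shows "mcoeff (mps_exp power_sum_series) m = g m / mon_fact m"
proof -
  define B where "B = Mps (\<lambda>m. g m / mon_fact m)"
  have B: "mcoeff B m = g m / mon_fact m" for m by (simp add: B_def Mps_inverse)
  have "mps_exp power_sum_series = B"
  proof (rule mps_exp_unique[OF mcoeff_power_sum_series_0])
    show "mcoeff B 0 = 1" by (simp add: B g0)
    show "euler_deriv B = euler_deriv power_sum_series * B"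
    proof (rule mps_eqI)
      fix m
      have "mcoeff B (m - var_mon (Suc j)) = of_nat ((j + 1) * lookup m j) * mcoeff B m" if "j \<in> keys m" for j
      proof -
        have l: "lookup m j \<noteq> 0" using that by (simp add: in_keys_iff)
        then have "m = var_mon (Suc j) + (m - var_mon (Suc j))"
          by (simp add: var_mon_add_minus)
        then have "g m = g (m - var_mon (Suc j)) / of_nat (Suc j)"
          using g_add[of "var_mon (Suc j)" "m - var_mon (Suc j)"] g_var by simp
        then have "g (m - var_mon (Suc j)) = of_nat (Suc j) * g m"
          by (simp add: field_simps del: of_nat_Suc)
        then have "g (m - var_mon (Suc j)) * (1 / mon_fact (m - var_mon (Suc j))) =
            of_nat (Suc j) * g m * (of_nat (lookup m j) / mon_fact m)"
          by (simp only: mon_fact_minus_var[OF l])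
        then show ?thesis by (simp add: B distrib_right)
      qed
      then show "mcoeff (euler_deriv B) m = mcoeff (euler_deriv power_sum_series * B) m"
        unfolding mcoeff_euler_deriv_linear_times[OF mcoeff_power_sum_series]
        by (simp add: mcoeff_euler_deriv wdeg_def sum_distrib_right)
    qed
  qed
  then show ?thesis by (simp add: B)
qed

section \<open>The rescaled generating functions\<close>

theorem theorem2p3:
  fixes I :: "graph_algebra \<Rightarrow> qpoly"
    and i :: "nat \<Rightarrow> complex"
    and a :: "nat \<Rightarrow> complex"
  assumes I: "umbral_invariant I"
    and i: "\<And>n. n \<ge> 1 \<Longrightarrow> i n = rescaling_const I n"
    and nonzero: "\<And>n. n \<ge> 1 \<Longrightarrow> i n \<noteq> 0"
    and a: "\<And>n. n \<ge> 1 \<Longrightarrow> a n = 2 ^ (n * (n - 1) div 2) * fact (n - 1) / i n"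
  shows "kp_solution (rescale a (gf_connected I)) \<and> kp_tau (rescale a (gf_all I))"
proof -
  define r where "r m = (\<Prod>k\<in>keys m. a (k + 1) ^ lookup m k)" for m
  define g where "g m = mon_fact m * mcoeff (gf_all I) m / 2 ^ (wdeg m choose 2) * r m" for m
  \<comment> \<open>\<open>g m / mon_fact m\<close> are the coefficients of the rescaled group-like series\<close>
  have r_add: "r (b + c) = r b * r c" for b c
    unfolding r_def by (rule prod_keys_add) (auto simp: power_add)
  have exp_g: "mcoeff (mps_exp power_sum_series) m = g m / mon_fact m" for m
  proof (rule mcoeff_mps_exp_power_sum_series)
    show "g 0 = 1" by (simp add: g_def r_def mcoeff_gf_all_0[OF I] choose_two)
    show "g (b + c) = g b * g c" for b c
      unfolding g_def r_add gf_all_group_like[OF I] by (simp only: mult_ac)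
    fix j
    have "i (Suc j) = fact (Suc j) * mcoeff (gf_all I) (var_mon (Suc j))"
      using i[of "Suc j"] rescaling_const_eq[OF I, of j] mcoeff_gf_connected_var[OF I, of j] by simp
    then have "mcoeff (gf_all I) (var_mon (Suc j)) = i (Suc j) / fact (Suc j)"
      by (simp del: fact_Suc)
    moreover have "r (var_mon (Suc j)) = 2 ^ (Suc j choose 2) * fact j / i (Suc j)"
      using a[of "Suc j"] by (simp add: r_def keys_var_mon lookup_var_mon choose_two)
    ultimately have "g (var_mon (Suc j)) = fact j / fact (Suc j)"
      using nonzero[of "Suc j"]
      by (simp add: g_def mon_fact_var_mon wdeg_var_mon del: fact_Suc)
    then show "g (var_mon (Suc j)) = 1 / of_nat (Suc j)" by simp
  qed
  have "mcoeff (rescale a (gf_all I)) m = 2 ^ (wdeg m choose 2) * mcoeff (mps_exp power_sum_series) m" for m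
    by (simp add: exp_g g_def r_def mcoeff_rescale mon_fact_nonzero)
  then have tau: "kp_tau (rescale a (gf_all I))"
    by (intro kp_tau_one_part[of "\<lambda>n. 2 ^ (n choose 2)"]) (simp_all add: choose_two)
  have F0: "mcoeff (rescale a (gf_connected I)) 0 = 0"
    by (simp add: mcoeff_rescale mcoeff_gf_connected_0[OF I])
  have "mps_exp (rescale a (gf_connected I)) = rescale a (gf_all I)"
  proof (rule mps_exp_unique[OF F0])
    show "mcoeff (rescale a (gf_all I)) 0 = 1"
      by (simp add: mcoeff_rescale mcoeff_gf_all_0[OF I])
    show "euler_deriv (rescale a (gf_all I)) = euler_deriv (rescale a (gf_connected I)) * rescale a (gf_all I)"
      unfolding euler_deriv_rescale euler_deriv_gf_all[OF I] rescale_times ..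
  qed
  then have "is_mps_log (rescale a (gf_connected I)) (rescale a (gf_all I))"
    using F0 by (simp add: is_mps_log_def)
  then show ?thesis using tau by (auto simp: kp_solution_def)
qed

end
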